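(* Let $n\ge 4$ be even and let $(M,g)$ be an $n$-dimensional Einstein manifold (any signature, not necessarily compact) which is not Ricci flat, with Einstein scale $\sigma$. For $k\in\{0,\dots,\frac n2-1\}$ put $p=\frac{n-2k}{2}$. The null space of the conformally invariant operator $L_k:\mathcal E^k\to\mathcal E_k$ is $$\mathcal N(L_k)=\widetilde{\mathcal H}^k_{\sigma,0}\oplus\bigoplus_{i=1}^{p-1}\widetilde{\mathcal H}^k_{\sigma,\lambda_i^{k+1}},\qquad k\in\{0,\dots,\tfrac n2-1\},$$ and $\mathcal N(L_{n/2})=\mathcal E^{n/2}=\mathcal E_{n/2}$.
   Context: $J=\mathrm{Sc}/(2(n-1))$ is the trace of the Schouten tensor of $g$; it is constant, and nonzero as $g$ is not Ricci flat. $\sigma$ is the density with $g=\sigma^{-2}\boldsymbol g$ ($\boldsymbol g$ the conformal metric); it is used to trivialise density bundles, so that $\mathcal E^k$ (smooth $k$-forms) and $\mathcal E_k=\mathcal E^k[2k-n]$ (density-weighted $k$-forms) are both identified with the space of smooth $k$-forms. $d$ is the exterior derivative and $\delta$ its formal adjoint with respect to $g$. $\mathcal N$ denotes null space. Definitions: $$L_k=\delta\prod_{i=1}^{\frac{n-2k-2}{2}}\Big(d\delta+\frac{2i(n-2k-i-1)}{n}J\Big)d\quad(k<n/2),\qquad L_{n/2}=0,$$ $$\widetilde{\mathcal H}^k_{\sigma,\lambda}=\{f\in\mathcal E^k\mid\delta df=\lambda f\},\qquad \lambda_i^k=-\frac{2i(n-2k-i+1)}{n}J .$$ *)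

theory Defs
  imports "HOL-Analysis.Analysis" "HOL-Library.Function_Algebras"
begin

section \<open>Smooth manifolds\<close>

text \<open>
  \<open>Ck_on r S f\<close>: on the open set \<open>S\<close> the function \<open>f\<close> is \<open>r\<close> times continuously differentiable.
\<close>

fun Ck_on :: "nat \<Rightarrow> 'v::euclidean_space set \<Rightarrow> ('v \<Rightarrow> 'w::real_normed_vector) \<Rightarrow> bool" where
  "Ck_on 0 S f \<longleftrightarrow> continuous_on S f"
| "Ck_on (Suc r) S f \<longleftrightarrow>
     (\<forall>y\<in>S. f differentiable (at y)) \<and> (\<forall>v. Ck_on r S (\<lambda>y. frechet_derivative f (at y) v))"

definition smooth_on :: "'v::euclidean_space set \<Rightarrow> ('v \<Rightarrow> 'w::real_normed_vector) \<Rightarrow> bool" where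
  "smooth_on S f \<longleftrightarrow> (\<forall>r. Ck_on r S f)"

text \<open>
  A chart is a pair of its domain and its coordinate map; only the values of the map on the domain
  matter. The dimension of the manifold is \<open>CARD('n)\<close>.
\<close>

type_synonym ('a, 'n) chart = "'a set \<times> ('a \<Rightarrow> real^'n)"

abbreviation cdom :: "('a, 'n::finite) chart \<Rightarrow> 'a set" where
  "cdom c \<equiv> fst c"

abbreviation cmap :: "('a, 'n::finite) chart \<Rightarrow> 'a \<Rightarrow> real^'n" where
  "cmap c \<equiv> snd c"

definition cimg :: "('a, 'n::finite) chart \<Rightarrow> (real^'n) set" where
  "cimg c = cmap c ` cdom c"

definition transition :: "('a, 'n::finite) chart \<Rightarrow> ('a, 'n) chart \<Rightarrow> real^'n \<Rightarrow> real^'n" where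
  "transition c c' = cmap c' \<circ> inv_into (cdom c) (cmap c)"

definition transition_deriv ::
    "('a, 'n::finite) chart \<Rightarrow> ('a, 'n) chart \<Rightarrow> 'a \<Rightarrow> real^'n \<Rightarrow> real^'n" where
  "transition_deriv c c' x = frechet_derivative (transition c c') (at (cmap c x))"

definition smooth_manifold :: "'a topology \<Rightarrow> ('a, 'n::finite) chart set \<Rightarrow> bool" where
  "smooth_manifold M A \<longleftrightarrow>
     Hausdorff_space M \<and> second_countable M \<and>
     topspace M = (\<Union>c\<in>A. cdom c) \<and>
     (\<forall>c\<in>A. openin M (cdom c) \<and> open (cimg c) \<and>
        homeomorphic_map (subtopology M (cdom c)) (top_of_set (cimg c)) (cmap c)) \<and>
     (\<forall>c\<in>A. \<forall>c'\<in>A. smooth_on (cmap c ` (cdom c \<inter> cdom c')) (transition c c'))"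

section \<open>Pseudo-Riemannian metrics and their curvature\<close>

text \<open>
  Tensor fields are families of local representatives indexed by the charts of the atlas, subject to
  the transformation law. \<open>g c y $ i $ j\<close> is the component \<open>g\<^sub>i\<^sub>j\<close> at the
  point with coordinates \<open>y\<close> in the chart \<open>c\<close>.
\<close>

type_synonym ('a, 'n) metric = "('a, 'n) chart \<Rightarrow> real^'n \<Rightarrow> real^'n^'n"

definition pseudo_riemannian_metric ::
    "('a, 'n::finite) chart set \<Rightarrow> ('a, 'n) metric \<Rightarrow> bool" where
  "pseudo_riemannian_metric A g \<longleftrightarrow>
     (\<forall>c\<in>A. smooth_on (cimg c) (g c) \<and>
        (\<forall>y\<in>cimg c. transpose (g c y) = g c y \<and> invertible (g c y))) \<and>
     (\<forall>c\<in>A. \<forall>c'\<in>A. \<forall>x\<in>cdom c \<inter> cdom c'. \<forall>u v.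
        u \<bullet> (g c (cmap c x) *v v) =
        transition_deriv c c' x u \<bullet> (g c' (cmap c' x) *v transition_deriv c c' x v))"

definition pderiv_at :: "'n::finite \<Rightarrow> (real^'n \<Rightarrow> real) \<Rightarrow> real^'n \<Rightarrow> real" where
  "pderiv_at i f y = frechet_derivative f (at y) (axis i 1)"

definition ginv :: "('a, 'n::finite) metric \<Rightarrow> ('a, 'n) chart \<Rightarrow> real^'n \<Rightarrow> real^'n^'n" where
  "ginv g c y = matrix_inv (g c y)"

text \<open>\<open>christoffel g c l i j\<close> is \<open>\<Gamma>\<^sup>l\<^sub>i\<^sub>j\<close>.\<close>

definition christoffel ::
    "('a, 'n::finite) metric \<Rightarrow> ('a, 'n) chart \<Rightarrow> 'n \<Rightarrow> 'n \<Rightarrow> 'n \<Rightarrow> real^'n \<Rightarrow> real" where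
  "christoffel g c l i j y =
     (1/2) * (\<Sum>m\<in>UNIV. ginv g c y $ l $ m *
        (pderiv_at i (\<lambda>z. g c z $ j $ m) y + pderiv_at j (\<lambda>z. g c z $ i $ m) y
         - pderiv_at m (\<lambda>z. g c z $ i $ j) y))"

text \<open>
  \<open>riemann g c l k i j\<close> is the \<open>\<partial>\<^sub>l\<close>-component of
  \<open>R(\<partial>\<^sub>i, \<partial>\<^sub>j) \<partial>\<^sub>k\<close>, where
  \<open>R(X, Y) = [\<nabla>\<^sub>X, \<nabla>\<^sub>Y] - \<nabla>\<^sub>[\<^sub>X\<^sub>,\<^sub>Y\<^sub>]\<close>;
  with the contraction below, round spheres have positive scalar curvature.
\<close>

definition riemann ::
    "('a, 'n::finite) metric \<Rightarrow> ('a, 'n) chart \<Rightarrow> 'n \<Rightarrow> 'n \<Rightarrow> 'n \<Rightarrow> 'n \<Rightarrow> real^'n \<Rightarrow> real" where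
  "riemann g c l k i j y =
     pderiv_at i (christoffel g c l j k) y - pderiv_at j (christoffel g c l i k) y
     + (\<Sum>m\<in>UNIV. christoffel g c l i m y * christoffel g c m j k y
                 - christoffel g c l j m y * christoffel g c m i k y)"

definition ricci ::
    "('a, 'n::finite) metric \<Rightarrow> ('a, 'n) chart \<Rightarrow> 'n \<Rightarrow> 'n \<Rightarrow> real^'n \<Rightarrow> real" where
  "ricci g c j k y = (\<Sum>i\<in>UNIV. riemann g c i k i j y)"

definition scal :: "('a, 'n::finite) metric \<Rightarrow> ('a, 'n) chart \<Rightarrow> real^'n \<Rightarrow> real" where
  "scal g c y = (\<Sum>i\<in>UNIV. \<Sum>j\<in>UNIV. ginv g c y $ i $ j * ricci g c i j y)"

definition einstein :: "('a, 'n::finite) chart set \<Rightarrow> ('a, 'n) metric \<Rightarrow> bool" where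
  "einstein A g \<longleftrightarrow>
     (\<exists>\<kappa>::real. \<forall>c\<in>A. \<forall>y\<in>cimg c. \<forall>i j. ricci g c i j y = \<kappa> * g c y $ i $ j)"

definition ricci_flat :: "('a, 'n::finite) chart set \<Rightarrow> ('a, 'n) metric \<Rightarrow> bool" where
  "ricci_flat A g \<longleftrightarrow> (\<forall>c\<in>A. \<forall>y\<in>cimg c. \<forall>i j. ricci g c i j y = 0)"

text \<open>
  The trace \<open>J = Sc / (2(n - 1))\<close> of the Schouten tensor, as a number; it is meaningful when
  the scalar curvature is constant, in particular for Einstein metrics (on nonempty manifolds).
\<close>

definition schouten_trace :: "('a, 'n::finite) chart set \<Rightarrow> ('a, 'n) metric \<Rightarrow> real" where
  "schouten_trace A g =
     (THE J. \<forall>c\<in>A. \<forall>y\<in>cimg c. J = scal g c y / (2 * (real CARD('n) - 1)))"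

section \<open>Differential forms\<close>

text \<open>
  \<open>\<omega> c y vs\<close> is the value of the local representative in the chart \<open>c\<close>, at the point with
  coordinates \<open>y\<close>, on the list \<open>vs\<close> of \<open>k\<close> tangent vectors. Outside the relevant arguments a form is
  required to vanish, so that equality of forms is equality of functions.
\<close>

type_synonym ('a, 'n) form = "('a, 'n) chart \<Rightarrow> real^'n \<Rightarrow> (real^'n) list \<Rightarrow> real"

text \<open>
  Sections of \<open>\<E>\<^sup>k[w]\<close>, the \<open>k\<close>-forms of conformal weight \<open>w\<close>. The bundle \<open>\<E>[-n]\<close> is that of
  1-densities, so that a section of \<open>\<E>[w]\<close> picks up the factor \<open>\<bar>det D\<tau>\<bar>\<close> to the power \<open>-w/n\<close>
  under a change of charts \<open>\<tau>\<close>.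
\<close>

definition weighted_forms ::
    "('a, 'n::finite) chart set \<Rightarrow> nat \<Rightarrow> real \<Rightarrow> ('a, 'n) form set" where
  "weighted_forms A k w = {\<omega>.
     (\<forall>c y vs. \<not> (c \<in> A \<and> y \<in> cimg c \<and> length vs = k) \<longrightarrow> \<omega> c y vs = 0) \<and>
     (\<forall>c\<in>A. \<forall>y\<in>cimg c. \<forall>vs i. length vs = k \<longrightarrow> i < k \<longrightarrow>
        linear (\<lambda>v. \<omega> c y (vs[i := v]))) \<and>
     (\<forall>c\<in>A. \<forall>y\<in>cimg c. \<forall>vs i j. length vs = k \<longrightarrow> i < j \<longrightarrow> j < k \<longrightarrow> vs ! i = vs ! j \<longrightarrow>
        \<omega> c y vs = 0) \<and>
     (\<forall>c\<in>A. \<forall>vs. length vs = k \<longrightarrow> smooth_on (cimg c) (\<lambda>y. \<omega> c y vs)) \<and>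
     (\<forall>c\<in>A. \<forall>c'\<in>A. \<forall>x\<in>cdom c \<inter> cdom c'. \<forall>vs. length vs = k \<longrightarrow>
        \<omega> c (cmap c x) vs =
        \<bar>det (matrix (transition_deriv c c' x))\<bar> powr (- w / real CARD('n)) *
        \<omega> c' (cmap c' x) (map (transition_deriv c c' x) vs))}"

text \<open>
  \<open>\<E>\<^sup>k = \<E>\<^sup>k[0]\<close> (the density factor is then 1, transition derivatives being invertible) and
  \<open>\<E>\<^sub>k = \<E>\<^sup>k[2k - n]\<close>.
\<close>

definition forms :: "('a, 'n::finite) chart set \<Rightarrow> nat \<Rightarrow> ('a, 'n) form set" where
  "forms A k = weighted_forms A k 0"

definition dual_forms :: "('a, 'n::finite) chart set \<Rightarrow> nat \<Rightarrow> ('a, 'n) form set" where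
  "dual_forms A k = weighted_forms A k (2 * real k - real CARD('n))"

definition form_scale :: "real \<Rightarrow> ('a, 'n::finite) form \<Rightarrow> ('a, 'n) form" where
  "form_scale r \<omega> = (\<lambda>c y vs. r * \<omega> c y vs)"

text \<open>
  The exterior derivative, in coordinates (so that the arguments \<open>v\<^sub>i\<close> are constant vector fields):
  \<open>(d\<omega>)(v\<^sub>0, \<dots>, v\<^sub>k) = \<Sum>\<^sub>i (-1)\<^sup>i \<partial>\<^sub>v\<^sub>i \<omega>(v\<^sub>0, \<dots>, v\<^sub>i\<^sub>-\<^sub>1, v\<^sub>i\<^sub>+\<^sub>1, \<dots>, v\<^sub>k)\<close>.
\<close>

definition ext_deriv :: "('a, 'n::finite) chart set \<Rightarrow> ('a, 'n) form \<Rightarrow> ('a, 'n) form" where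
  "ext_deriv A \<omega> = (\<lambda>c y vs.
     if c \<in> A \<and> y \<in> cimg c then
       (\<Sum>i<length vs. (-1) ^ i *
          frechet_derivative (\<lambda>z. \<omega> c z (take i vs @ drop (Suc i) vs)) (at y) (vs ! i))
     else 0)"

section \<open>The formal adjoint of the exterior derivative\<close>

text \<open>
  The measure \<open>\<bar>det g\<bar>\<^sup>1\<^sup>/\<^sup>2 dy\<close>; it requires no orientation.
\<close>

definition volume_measure ::
    "'a topology \<Rightarrow> ('a, 'n::finite) chart set \<Rightarrow> ('a, 'n) metric \<Rightarrow> 'a measure \<Rightarrow> bool" where
  "volume_measure M A g \<mu> \<longleftrightarrow>
     space \<mu> = topspace M \<and>
     sets \<mu> = sigma_sets (topspace M) {U. openin M U} \<and>
     (\<forall>c\<in>A. \<forall>E\<in>sets \<mu>. E \<subseteq> cdom c \<longrightarrow>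
        emeasure \<mu> E = (\<integral>\<^sup>+ y. ennreal (sqrt \<bar>det (g c y)\<bar>) * indicator (cmap c ` E) y \<partial>lborel))"

text \<open>
  \<open>\<langle>\<alpha>, \<beta>\<rangle> = (1/k!) g\<^sup>i\<^sup>1\<^sup>j\<^sup>1 \<cdots> g\<^sup>i\<^sup>k\<^sup>j\<^sup>k \<alpha>\<^sub>i\<^sub>1\<^sub>\<dots>\<^sub>i\<^sub>k \<beta>\<^sub>j\<^sub>1\<^sub>\<dots>\<^sub>j\<^sub>k\<close>, for which
  \<open>\<langle>dx\<^sup>I, dx\<^sup>J\<rangle>\<close> is the determinant of the matrix of the \<open>g\<^sup>i\<^sup>j\<close> with \<open>i\<close> in \<open>I\<close>, \<open>j\<close> in \<open>J\<close>.
\<close>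

definition form_inner_coord ::
    "('a, 'n::finite) metric \<Rightarrow> nat \<Rightarrow> ('a, 'n) form \<Rightarrow> ('a, 'n) form \<Rightarrow>
     ('a, 'n) chart \<Rightarrow> real^'n \<Rightarrow> real" where
  "form_inner_coord g k \<alpha> \<beta> c y =
     (1 / fact k) *
     (\<Sum>I | length I = k. \<Sum>J | length J = k.
        (\<Prod>r<k. ginv g c y $ (I ! r) $ (J ! r)) *
        \<alpha> c y (map (\<lambda>i. axis i 1) I) * \<beta> c y (map (\<lambda>j. axis j 1) J))"

text \<open>The choice of chart is immaterial, by the transformation laws.\<close>

definition form_inner ::
    "('a, 'n::finite) chart set \<Rightarrow> ('a, 'n) metric \<Rightarrow> nat \<Rightarrow> ('a, 'n) form \<Rightarrow> ('a, 'n) form \<Rightarrow>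
     'a \<Rightarrow> real" where
  "form_inner A g k \<alpha> \<beta> x =
     (let c = (SOME c. c \<in> A \<and> x \<in> cdom c) in form_inner_coord g k \<alpha> \<beta> c (cmap c x))"

definition compactly_supported ::
    "'a topology \<Rightarrow> ('a, 'n::finite) chart set \<Rightarrow> ('a, 'n) form \<Rightarrow> bool" where
  "compactly_supported M A \<omega> \<longleftrightarrow>
     compactin M (M closure_of {x. \<exists>c\<in>A. x \<in> cdom c \<and> (\<exists>vs. \<omega> c (cmap c x) vs \<noteq> 0)})"

text \<open>
  \<open>\<delta>\<close> is the formal adjoint of \<open>d\<close>: the linear operator \<open>\<E>\<^sup>k\<^sup>+\<^sup>1 \<rightarrow> \<E>\<^sup>k\<close>, for each \<open>k\<close>, with
  \<open>\<integral> \<langle>d\<alpha>, \<beta>\<rangle> = \<integral> \<langle>\<alpha>, \<delta>\<beta>\<rangle>\<close> for all \<open>\<beta>\<close> and all test forms \<open>\<alpha>\<close>. On smooth forms of positive degree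
  this determines \<open>\<delta>\<close>.
\<close>

definition formal_adjoint_d ::
    "'a topology \<Rightarrow> ('a, 'n::finite) chart set \<Rightarrow> ('a, 'n) metric \<Rightarrow> 'a measure \<Rightarrow>
     (('a, 'n) form \<Rightarrow> ('a, 'n) form) \<Rightarrow> bool" where
  "formal_adjoint_d M A g \<mu> \<delta> \<longleftrightarrow> (\<forall>k.
     (\<forall>\<beta>\<in>forms A (Suc k). \<delta> \<beta> \<in> forms A k) \<and>
     (\<forall>\<beta>\<in>forms A (Suc k). \<forall>\<beta>'\<in>forms A (Suc k). \<delta> (\<beta> + \<beta>') = \<delta> \<beta> + \<delta> \<beta>') \<and>
     (\<forall>r. \<forall>\<beta>\<in>forms A (Suc k). \<delta> (form_scale r \<beta>) = form_scale r (\<delta> \<beta>)) \<and>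
     (\<forall>\<alpha>\<in>forms A k. \<forall>\<beta>\<in>forms A (Suc k). compactly_supported M A \<alpha> \<longrightarrow>
        (LINT x|\<mu>. form_inner A g (Suc k) (ext_deriv A \<alpha>) \<beta> x) =
        (LINT x|\<mu>. form_inner A g k \<alpha> (\<delta> \<beta>) x)))"

section \<open>The operators \<open>L\<^sub>k\<close> and their null spaces\<close>

text \<open>
  The scale \<open>\<sigma>\<close>, a section of \<open>\<E>[1]\<close>. The conformal metric of the class of \<open>g\<close> has the local
  representative \<open>\<bar>det g\<bar>\<close> to the power \<open>-1/n\<close> times \<open>g\<close>, and it equals \<open>\<sigma>\<^sup>2 g\<close>.
\<close>

definition scale_density ::
    "('a, 'n::finite) metric \<Rightarrow> ('a, 'n) chart \<Rightarrow> real^'n \<Rightarrow> real" where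
  "scale_density g c y = \<bar>det (g c y)\<bar> powr (- 1 / (2 * real CARD('n)))"

text \<open>The product (composition) of \<open>d\<delta> + 2i(n - 2k - i - 1)/n J\<close> over \<open>i = 1, \<dots>, m\<close>.\<close>

fun L_product ::
    "('a, 'n::finite) chart set \<Rightarrow> ('a, 'n) metric \<Rightarrow> (('a, 'n) form \<Rightarrow> ('a, 'n) form) \<Rightarrow>
     nat \<Rightarrow> nat \<Rightarrow> ('a, 'n) form \<Rightarrow> ('a, 'n) form" where
  "L_product A g \<delta> k 0 \<omega> = \<omega>"
| "L_product A g \<delta> k (Suc m) \<omega> =
     (let \<eta> = L_product A g \<delta> k m \<omega>; n = real CARD('n); i = real (Suc m)
      in ext_deriv A (\<delta> \<eta>) +
         form_scale (2 * i * (n - 2 * real k - i - 1) / n * schouten_trace A g) \<eta>)"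

text \<open>
  \<open>L\<^sub>k\<close> as an operator \<open>\<E>\<^sup>k \<rightarrow> \<E>\<^sub>k\<close>: multiplication by the power \<open>2k - n\<close> of \<open>\<sigma>\<close> undoes the
  trivialisation of \<open>\<E>[2k - n]\<close>. Only \<open>2k \<le> n\<close> is meaningful.
\<close>

definition L_op ::
    "('a, 'n::finite) chart set \<Rightarrow> ('a, 'n) metric \<Rightarrow> (('a, 'n) form \<Rightarrow> ('a, 'n) form) \<Rightarrow>
     nat \<Rightarrow> ('a, 'n) form \<Rightarrow> ('a, 'n) form" where
  "L_op A g \<delta> k f =
     (if 2 * k < CARD('n) then
        (\<lambda>c y vs. scale_density g c y powr (2 * real k - real CARD('n)) *
           \<delta> (L_product A g \<delta> k ((CARD('n) - 2 * k - 2) div 2) (ext_deriv A f)) c y vs)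
      else 0)"

definition null_L ::
    "('a, 'n::finite) chart set \<Rightarrow> ('a, 'n) metric \<Rightarrow> (('a, 'n) form \<Rightarrow> ('a, 'n) form) \<Rightarrow>
     nat \<Rightarrow> ('a, 'n) form set" where
  "null_L A g \<delta> k = {f \<in> forms A k. L_op A g \<delta> k f = 0}"

definition H_tilde ::
    "('a, 'n::finite) chart set \<Rightarrow> (('a, 'n) form \<Rightarrow> ('a, 'n) form) \<Rightarrow> nat \<Rightarrow> real \<Rightarrow>
     ('a, 'n) form set" where
  "H_tilde A \<delta> k ev = {f \<in> forms A k. \<delta> (ext_deriv A f) = form_scale ev f}"

definition eigenval ::
    "('a, 'n::finite) chart set \<Rightarrow> ('a, 'n) metric \<Rightarrow> nat \<Rightarrow> nat \<Rightarrow> real" where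
  "eigenval A g k i =
     - (2 * real i * (real CARD('n) - 2 * real k - real i + 1) / real CARD('n)) * schouten_trace A g"

text \<open>
  \<open>V\<close> is the internal direct sum of the finite family \<open>W\<close>: addition is a bijection from the product
  of the \<open>W i\<close> onto \<open>V\<close>.
\<close>

definition is_direct_sum ::
    "'v::comm_monoid_add set \<Rightarrow> 'i set \<Rightarrow> ('i \<Rightarrow> 'v set) \<Rightarrow> bool" where
  "is_direct_sum V I W \<longleftrightarrow> finite I \<and> bij_betw (\<lambda>w. \<Sum>i\<in>I. w i) (PiE I W) V"

end

theory Submission
  imports Defs
begin

text \<open>
  Write \<open>n = 2 k + 2 p\<close> and \<open>\<lambda>\<^sub>i\<close> for the numbers \<open>eigenval A g (k + 1) i\<close>, so that \<open>\<lambda>\<^sub>0 = 0\<close>. The numbers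
  added to \<open>d\<delta>\<close> in the factors of \<open>L\<^sub>k\<close> are the \<open>-\<lambda>\<^sub>i\<close> with \<open>1 \<le> i \<le> p - 1\<close>. Moving the rightmost \<open>d\<close> to the
  left through the product by \<open>(d\<delta> - \<lambda>) d = d (\<delta>d - \<lambda>)\<close> shows that, up to a nowhere vanishing power of
  the scale, \<open>L\<^sub>k\<close> is a polynomial in the single operator \<open>T = \<delta>d\<close> on \<open>k\<close>-forms:

    \<open>L\<^sub>k = T (T - \<lambda>\<^sub>1) \<cdots> (T - \<lambda>\<^sub>p\<^sub>-\<^sub>1)\<close>

  (lemmas \<open>L_product_ext_deriv\<close> and \<open>null_L_eq_kernel\<close>). The roots \<open>\<lambda>\<^sub>i\<close> are nonzero multiples of
  \<open>i (2 p - 1 - i)\<close>, because the Schouten trace of an Einstein metric that is not Ricci flat is nonzero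
  (\<open>schouten_trace_nonzero\<close>); hence they are distinct for \<open>0 \<le> i \<le> p - 1\<close> (\<open>eigenval_inj\<close>). The kernel
  of a polynomial with distinct roots in a linear operator is the direct sum of the eigenspaces for
  these roots, also in infinite dimension (\<open>kernel_shift_product\<close>). In the middle
  degree \<open>L\<^sub>n\<^sub>/\<^sub>2\<close> is zero and the weight \<open>2 k - n\<close> is zero.

  For this \<open>T\<close> has to be a linear operator on the space of \<open>k\<close>-forms. While \<open>\<delta>\<close> is given as
  a linear map between spaces of forms, \<open>d\<close> is defined by a formula in coordinates, and one has to see that its
  values are forms (\<open>ext_deriv_forms\<close>). The essential point is independence of the chart
  (\<open>ext_deriv_transform\<close>): the second derivatives of the transition maps, which arise from
  differentiating the pushed forward arguments (\<open>multilinear_chain_rule\<close>), are symmetric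
  (\<open>second_derivative_symmetric\<close>) and cancel against the alternating signs
  (\<open>alternating_sum_symmetric_insertion\<close>).
\<close>

section \<open>Smooth functions and symmetry of second derivatives\<close>

lemma Ck_on_cong:
  assumes "open S" "\<And>y. y \<in> S \<Longrightarrow> f y = g y" "Ck_on r S f"
  shows "Ck_on r S g"
  using assms(2,3)
proof (induction r arbitrary: f g)
  case 0
  then show ?case using continuous_on_cong by force
next
  case (Suc r)
  have der: "(g has_derivative frechet_derivative f (at y)) (at y)" if "y \<in> S" for y
  proof (rule has_derivative_transform_within_open[OF _ \<open>open S\<close> that])
    show "(f has_derivative frechet_derivative f (at y)) (at y)"
      using Suc.prems(2) that by (simp flip: frechet_derivative_works)
  qed (use Suc.prems(1) in auto)
  then have eq: "frechet_derivative g (at y) = frechet_derivative f (at y)" if "y \<in> S" for y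
    using that frechet_derivative_at by metis
  have "Ck_on r S (\<lambda>y. frechet_derivative g (at y) v)" for v
    using Suc.IH[of "\<lambda>y. frechet_derivative f (at y) v" "\<lambda>y. frechet_derivative g (at y) v"]
      Suc.prems(2) eq by simp
  then show ?case using differentiableI[OF der] by auto
qed

lemma Ck_on_add:
  assumes "open S" "Ck_on r S f" "Ck_on r S g"
  shows "Ck_on r S (\<lambda>y. f y + g y)"
  using assms(2,3)
proof (induction r arbitrary: f g)
  case 0
  then show ?case by (auto intro: continuous_intros)
next
  case (Suc r)
  have "((\<lambda>y. f y + g y) has_derivative
      (\<lambda>v. frechet_derivative f (at y) v + frechet_derivative g (at y) v)) (at y)" if "y \<in> S" for y
    using Suc.prems that by (intro has_derivative_add) (simp_all flip: frechet_derivative_works)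
  note der = fun_cong[OF frechet_derivative_at[OF this]]
  have "Ck_on r S (\<lambda>y. frechet_derivative f (at y) v + frechet_derivative g (at y) v)" for v
    using Suc.prems by (intro Suc.IH) simp_all
  then have "Ck_on r S (\<lambda>y. frechet_derivative (\<lambda>y. f y + g y) (at y) v)" for v
    using der by (rule Ck_on_cong[OF \<open>open S\<close>, rotated])
  then show ?case using Suc.prems by auto
qed

lemma Ck_on_const: "Ck_on r S (\<lambda>y. c)"
  by (induction r arbitrary: c) auto

lemma Ck_on_scaleR:
  assumes "open S" "Ck_on r S f"
  shows "Ck_on r S (\<lambda>y. a *\<^sub>R f y)"
  using assms(2)
proof (induction r arbitrary: f)
  case 0
  then show ?case by (auto intro: continuous_intros)
next
  case (Suc r)
  have "((\<lambda>y. a *\<^sub>R f y) has_derivative (\<lambda>v. a *\<^sub>R frechet_derivative f (at y) v)) (at y)"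
    if "y \<in> S" for y
    using Suc.prems that by (intro has_derivative_scaleR_right) (simp flip: frechet_derivative_works)
  note der = fun_cong[OF frechet_derivative_at[OF this]]
  have "Ck_on r S (\<lambda>y. a *\<^sub>R frechet_derivative f (at y) v)" for v
    using Suc.prems by (intro Suc.IH) simp_all
  then have "Ck_on r S (\<lambda>y. frechet_derivative (\<lambda>y. a *\<^sub>R f y) (at y) v)" for v
    using der by (rule Ck_on_cong[OF \<open>open S\<close>, rotated])
  then show ?case using Suc.prems by auto
qed

lemma smooth_on_cong:
  assumes "open S" "smooth_on S f" "\<And>y. y \<in> S \<Longrightarrow> f y = g y"
  shows "smooth_on S g"
  using assms Ck_on_cong[of S f g] unfolding smooth_on_def by blast

lemma smooth_on_const: "smooth_on S (\<lambda>y. c)"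
  by (simp add: smooth_on_def Ck_on_const)

lemma smooth_on_add:
  "open S \<Longrightarrow> smooth_on S f \<Longrightarrow> smooth_on S g \<Longrightarrow> smooth_on S (\<lambda>y. f y + g y)"
  by (simp add: smooth_on_def Ck_on_add)

lemma smooth_on_cmult:
  fixes f :: "'v::euclidean_space \<Rightarrow> real"
  shows "open S \<Longrightarrow> smooth_on S f \<Longrightarrow> smooth_on S (\<lambda>y. a * f y)"
  using Ck_on_scaleR[of S _ f a] by (simp add: smooth_on_def)

lemma smooth_on_sum:
  assumes "open S" "\<And>i. i \<in> I \<Longrightarrow> smooth_on S (f i)"
  shows "smooth_on S (\<lambda>y. \<Sum>i\<in>I. f i y)"
  using assms(2)
  by (induction I rule: infinite_finite_induct)
    (auto intro: smooth_on_const smooth_on_add[OF \<open>open S\<close>])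

lemma smooth_on_directional_deriv:
  "smooth_on S f \<Longrightarrow> smooth_on S (\<lambda>y. frechet_derivative f (at y) v)"
  unfolding smooth_on_def by (metis Ck_on.simps(2))

lemma smooth_on_has_derivative:
  assumes "smooth_on S f" "y \<in> S"
  shows "(f has_derivative frechet_derivative f (at y)) (at y)"
  using assms unfolding smooth_on_def
  by (metis Ck_on.simps(2) frechet_derivative_works)

lemma smooth_on_continuous_on: "smooth_on S f \<Longrightarrow> continuous_on S f"
  unfolding smooth_on_def by (metis Ck_on.simps(1))

text \<open>
  The mean value theorem is applied along \<open>u\<close> and then along \<open>v\<close>. The second difference on the left
  is symmetric in \<open>u\<close> and \<open>v\<close>, while the order of the two applications selects one of the two mixed
  derivatives on the right; comparing both orders gives the symmetry of second derivatives.
\<close>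

lemma second_difference_mean_value:
  fixes f :: "'v::euclidean_space \<Rightarrow> 'w::real_inner"
  assumes "smooth_on S f" "0 < t"
    and inS: "\<And>p q. 0 \<le> p \<Longrightarrow> p \<le> t \<Longrightarrow> 0 \<le> q \<Longrightarrow> q \<le> t \<Longrightarrow> z + p *\<^sub>R u + q *\<^sub>R v \<in> S"
  obtains p q where "0 \<le> p" "p \<le> t" "0 \<le> q" "q \<le> t"
    "b \<bullet> (f (z + t *\<^sub>R u + t *\<^sub>R v) - f (z + t *\<^sub>R u) - f (z + t *\<^sub>R v) + f z) =
     t * t * (b \<bullet> frechet_derivative (\<lambda>y. frechet_derivative f (at y) u)
       (at (z + p *\<^sub>R u + q *\<^sub>R v)) v)"
proof -
  let ?D = "\<lambda>y. frechet_derivative f (at y) u"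
  have line: "((\<lambda>s. b \<bullet> h (a + s *\<^sub>R e)) has_real_derivative
      b \<bullet> frechet_derivative h (at (a + s *\<^sub>R e)) e) (at s)"
    if "smooth_on S h" "a + s *\<^sub>R e \<in> S" for h :: "'v \<Rightarrow> 'w" and a e s
  proof -
    have *: "(h has_derivative frechet_derivative h (at (a + s *\<^sub>R e))) (at (a + s *\<^sub>R e))"
      using that by (rule smooth_on_has_derivative)
    then have "linear (frechet_derivative h (at (a + s *\<^sub>R e)))"
      by (rule has_derivative_linear)
    then have **: "frechet_derivative h (at (a + s *\<^sub>R e)) (r *\<^sub>R e) =
        r *\<^sub>R frechet_derivative h (at (a + s *\<^sub>R e)) e" for r
      by (rule linear_scale)
    have "((\<lambda>s. b \<bullet> h (a + s *\<^sub>R e)) has_derivative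
        (\<lambda>r. b \<bullet> frechet_derivative h (at (a + s *\<^sub>R e)) (r *\<^sub>R e))) (at s)"
      by (intro has_derivative_inner_right has_derivative_compose[where g = h and f = "\<lambda>s. a + s *\<^sub>R e", OF _ *])
        (auto intro!: derivative_eq_intros)
    then show ?thesis
      by (rule has_derivative_imp_has_field_derivative) (simp add: **)
  qed
  have shift: "z + t *\<^sub>R v + s *\<^sub>R u = z + s *\<^sub>R u + t *\<^sub>R v" for s
    by (simp add: algebra_simps)
  have "((\<lambda>s. b \<bullet> f (z + t *\<^sub>R v + s *\<^sub>R u) - b \<bullet> f (z + s *\<^sub>R u)) has_real_derivative
      b \<bullet> ?D (z + t *\<^sub>R v + s *\<^sub>R u) - b \<bullet> ?D (z + s *\<^sub>R u)) (at s)" if "0 \<le> s" "s \<le> t" for s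
    by (intro derivative_intros line assms(1))
      (use inS[of s t] inS[of s 0] that \<open>0 < t\<close> in \<open>auto simp: shift\<close>)
  from MVT2[OF \<open>0 < t\<close> this] obtain p where p: "0 < p" "p < t"
    "b \<bullet> f (z + t *\<^sub>R v + t *\<^sub>R u) - b \<bullet> f (z + t *\<^sub>R u) -
       (b \<bullet> f (z + t *\<^sub>R v + 0 *\<^sub>R u) - b \<bullet> f (z + 0 *\<^sub>R u)) =
     (t - 0) * (b \<bullet> ?D (z + t *\<^sub>R v + p *\<^sub>R u) - b \<bullet> ?D (z + p *\<^sub>R u))"
    by auto
  have "((\<lambda>s. b \<bullet> ?D (z + p *\<^sub>R u + s *\<^sub>R v)) has_real_derivative
      b \<bullet> frechet_derivative ?D (at (z + p *\<^sub>R u + s *\<^sub>R v)) v) (at s)" if "0 \<le> s" "s \<le> t" for s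
    by (intro line smooth_on_directional_deriv assms(1)) (use inS[of p s] that p in auto)
  from MVT2[OF \<open>0 < t\<close> this] obtain q where q: "0 < q" "q < t"
    "b \<bullet> ?D (z + p *\<^sub>R u + t *\<^sub>R v) - b \<bullet> ?D (z + p *\<^sub>R u + 0 *\<^sub>R v) =
     (t - 0) * (b \<bullet> frechet_derivative ?D (at (z + p *\<^sub>R u + q *\<^sub>R v)) v)"
    by auto
  show thesis
    using that[of p q] p q by (simp add: shift inner_diff_right inner_add_right algebra_simps)
qed

lemma second_derivative_symmetric:
  fixes f :: "'v::euclidean_space \<Rightarrow> 'w::real_inner"
  assumes "open S" "smooth_on S f" "z \<in> S"
  shows "frechet_derivative (\<lambda>y. frechet_derivative f (at y) u) (at z) v =
         frechet_derivative (\<lambda>y. frechet_derivative f (at y) v) (at z) u"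
proof (rule ccontr)
  let ?P = "\<lambda>u v y. frechet_derivative (\<lambda>y. frechet_derivative f (at y) u) (at y) v"
  define b where "b = ?P u v z - ?P v u z"
  assume "\<not> ?thesis"
  then have "0 < b \<bullet> b" by (simp add: b_def)
  have cont: "continuous_on S (?P u v)" for u v
    by (intro smooth_on_continuous_on smooth_on_directional_deriv assms)
  define e where "e = b \<bullet> b / 2"
  have "0 < e" using \<open>0 < b \<bullet> b\<close> by (simp add: e_def)
  \<comment> \<open>Near \<open>z\<close> the components of the two second derivatives along their difference at \<open>z\<close> stay apart.\<close>
  have near: "\<exists>r>0. ball z r \<subseteq> S \<and> (\<forall>y\<in>ball z r. \<bar>b \<bullet> ?P u v y - b \<bullet> ?P u v z\<bar> < e)" for u v
  proof -
    obtain r1 where r1: "r1 > 0" "ball z r1 \<subseteq> S"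
      using assms openE by blast
    have "continuous_on S (\<lambda>y. b \<bullet> ?P u v y)"
      by (intro continuous_intros cont)
    then obtain r2 where r2: "r2 > 0"
      "\<And>y. y \<in> S \<Longrightarrow> dist y z < r2 \<Longrightarrow> dist (b \<bullet> ?P u v y) (b \<bullet> ?P u v z) < e"
      using \<open>z \<in> S\<close> \<open>0 < e\<close> unfolding continuous_on_iff by metis
    show ?thesis
      using r1 r2 by (intro exI[of _ "min r1 r2"]) (auto simp: dist_real_def dist_commute[of z] subset_iff)
  qed
  obtain r1 where r1: "r1 > 0" "ball z r1 \<subseteq> S"
      "\<And>y. y \<in> ball z r1 \<Longrightarrow> \<bar>b \<bullet> ?P u v y - b \<bullet> ?P u v z\<bar> < e"
    using near[of u v] by blast
  obtain r2 where r2: "r2 > 0" "\<And>y. y \<in> ball z r2 \<Longrightarrow> \<bar>b \<bullet> ?P v u y - b \<bullet> ?P v u z\<bar> < e"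
    using near[of v u] by blast
  define r where "r = min r1 r2"
  define t where "t = r / (2 * (norm u + norm v + 1))"
  have "0 < r" using r1 r2 by (simp add: r_def)
  have "0 < norm u + norm v + 1"
    by (intro add_nonneg_pos) auto
  then have "0 < t" using \<open>0 < r\<close> by (simp add: t_def)
  have tr: "t * (norm u + norm v) < r"
  proof -
    have "t * (norm u + norm v) \<le> t * (norm u + norm v + 1)"
      using \<open>0 < t\<close> by simp
    also have "\<dots> = r / 2"
      using \<open>0 < norm u + norm v + 1\<close> by (simp add: t_def field_simps)
    finally show ?thesis using \<open>0 < r\<close> by simp
  qed
  have small: "z + p *\<^sub>R u + q *\<^sub>R v \<in> ball z r"
    if "0 \<le> p" "p \<le> t" "0 \<le> q" "q \<le> t" for p q
  proof -
    have "norm (p *\<^sub>R u + q *\<^sub>R v) \<le> p * norm u + q * norm v"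
      using that norm_triangle_ineq[of "p *\<^sub>R u" "q *\<^sub>R v"] by simp
    also have "\<dots> \<le> t * norm u + t * norm v"
      using that by (intro add_mono mult_right_mono) auto
    also have "\<dots> < r" using tr by (simp add: algebra_simps)
    also have "norm (p *\<^sub>R u + q *\<^sub>R v) = dist z (z + p *\<^sub>R u + q *\<^sub>R v)"
      by (subst dist_commute) (simp add: dist_norm)
    finally show ?thesis by simp
  qed
  have small': "z + p *\<^sub>R v + q *\<^sub>R u \<in> ball z r"
    if "0 \<le> p" "p \<le> t" "0 \<le> q" "q \<le> t" for p q
    using small[of q p] that by (simp add: algebra_simps)
  have sub: "ball z r \<subseteq> S" "ball z r \<subseteq> ball z r1" "ball z r \<subseteq> ball z r2"
    using r1 by (auto simp: r_def)
  obtain p q where pq: "0 \<le> p" "p \<le> t" "0 \<le> q" "q \<le> t"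
    "b \<bullet> (f (z + t *\<^sub>R u + t *\<^sub>R v) - f (z + t *\<^sub>R u) - f (z + t *\<^sub>R v) + f z) =
     t * t * (b \<bullet> ?P u v (z + p *\<^sub>R u + q *\<^sub>R v))"
    using second_difference_mean_value[OF \<open>smooth_on S f\<close> \<open>0 < t\<close>, of z u v b thesis] small sub
    by blast
  obtain p' q' where pq': "0 \<le> p'" "p' \<le> t" "0 \<le> q'" "q' \<le> t"
    "b \<bullet> (f (z + t *\<^sub>R v + t *\<^sub>R u) - f (z + t *\<^sub>R v) - f (z + t *\<^sub>R u) + f z) =
     t * t * (b \<bullet> ?P v u (z + p' *\<^sub>R v + q' *\<^sub>R u))"
    using second_difference_mean_value[OF \<open>smooth_on S f\<close> \<open>0 < t\<close>, of z v u b thesis] small' sub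
    by blast
  have "f (z + t *\<^sub>R v + t *\<^sub>R u) - f (z + t *\<^sub>R v) - f (z + t *\<^sub>R u) + f z =
        f (z + t *\<^sub>R u + t *\<^sub>R v) - f (z + t *\<^sub>R u) - f (z + t *\<^sub>R v) + f z"
    by (simp add: algebra_simps)
  then have "b \<bullet> ?P u v (z + p *\<^sub>R u + q *\<^sub>R v) = b \<bullet> ?P v u (z + p' *\<^sub>R v + q' *\<^sub>R u)"
    using pq(5) pq'(5) \<open>0 < t\<close> by (metis mult_cancel_left mult_pos_pos less_irrefl)
  moreover have "\<bar>b \<bullet> ?P u v (z + p *\<^sub>R u + q *\<^sub>R v) - b \<bullet> ?P u v z\<bar> < e"
    using r1(3) small pq sub by blast
  moreover have "\<bar>b \<bullet> ?P v u (z + p' *\<^sub>R v + q' *\<^sub>R u) - b \<bullet> ?P v u z\<bar> < e"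
    using r2(2) small' pq' sub by blast
  ultimately have "\<bar>b \<bullet> ?P u v z - b \<bullet> ?P v u z\<bar> < 2 * e"
    by linarith
  moreover have "b \<bullet> ?P u v z - b \<bullet> ?P v u z = b \<bullet> b"
    by (simp add: b_def inner_diff_right)
  ultimately show False using \<open>0 < e\<close> by (simp add: e_def)
qed


section \<open>Alternating multilinear functions of lists\<close>

definition multilinear :: "nat \<Rightarrow> ('v::real_vector list \<Rightarrow> real) \<Rightarrow> bool" where
  "multilinear k \<phi> \<longleftrightarrow>
     (\<forall>vs i. length vs = k \<longrightarrow> i < k \<longrightarrow> linear (\<lambda>v. \<phi> (vs[i := v])))"

definition alternating :: "nat \<Rightarrow> ('v::real_vector list \<Rightarrow> real) \<Rightarrow> bool" where
  "alternating k \<phi> \<longleftrightarrow> multilinear k \<phi> \<and>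
     (\<forall>vs i j. length vs = k \<longrightarrow> i < j \<longrightarrow> j < k \<longrightarrow> vs ! i = vs ! j \<longrightarrow> \<phi> vs = 0)"

definition del_nth :: "nat \<Rightarrow> 'v list \<Rightarrow> 'v list" where
  "del_nth i vs = take i vs @ drop (Suc i) vs"

lemma length_del_nth [simp]: "i < length vs \<Longrightarrow> length (del_nth i vs) = length vs - 1"
  by (simp add: del_nth_def)

lemma map_del_nth: "map f (del_nth i vs) = del_nth i (map f vs)"
  by (simp add: del_nth_def take_map drop_map)

lemma nth_del_nth:
  "i < length vs \<Longrightarrow> j < length vs - 1 \<Longrightarrow> del_nth i vs ! j = vs ! (if j < i then j else Suc j)"
  by (auto simp: del_nth_def nth_append min_def)

lemma del_nth_update:
  "i < length vs \<Longrightarrow> j < length vs \<Longrightarrow> i \<noteq> j \<Longrightarrow>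
   del_nth i (vs[j := x]) = (del_nth i vs)[(if j < i then j else j - 1) := x]"
  by (rule nth_equalityI) (auto simp: nth_del_nth nth_list_update)

lemma del_nth_update_same: "del_nth i (vs[i := x]) = del_nth i vs"
  by (simp add: del_nth_def)

lemma multilinear_linear_append:
  assumes "multilinear k \<phi>" "length p + length q + 1 = k"
  shows "linear (\<lambda>v. \<phi> (p @ v # q))"
proof -
  have "linear (\<lambda>v. \<phi> ((p @ undefined # q)[length p := v]))"
    using assms unfolding multilinear_def
    by (elim allE[of _ "p @ undefined # q"] impE allE[of _ "length p"]) simp_all
  then show ?thesis by simp
qed

lemma adjacent_swap:
  assumes "multilinear k \<phi>" "length p + length q + 2 = k"
    and zero: "\<And>x. \<phi> (p @ x # x # q) = 0"
  shows "\<phi> (p @ x # y # q) = - \<phi> (p @ y # x # q)"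
proof -
  have l1: "linear (\<lambda>v. \<phi> (p @ v # w # q))" for w
    using multilinear_linear_append[OF assms(1), of p "w # q"] assms(2) by simp
  have l2: "linear (\<lambda>v. \<phi> (p @ w # v # q))" for w
    using multilinear_linear_append[OF assms(1), of "p @ [w]" q] assms(2) by simp
  have "0 = \<phi> (p @ (x + y) # (x + y) # q)" using zero by simp
  also have "\<dots> = \<phi> (p @ x # x # q) + \<phi> (p @ x # y # q) +
      (\<phi> (p @ y # x # q) + \<phi> (p @ y # y # q))"
    by (simp add: linear_add[OF l1] linear_add[OF l2])
  finally show ?thesis using zero by simp
qed

text \<open>
  If equal adjacent arguments give zero, then adjacent arguments can be swapped up to sign, and two
  equal arguments can be brought next to each other.
\<close>

lemma alternating_adjacentI:
  assumes "multilinear k \<phi>"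
    and adj: "\<And>p x q. length p + length q + 2 = k \<Longrightarrow> \<phi> (p @ x # x # q) = 0"
  shows "alternating k \<phi>"
proof -
  have "\<phi> (p @ x # m @ x # q) = 0" if "length p + length m + length q + 2 = k" for p m x q
    using that
  proof (induction m arbitrary: p)
    case Nil
    then show ?case using adj by simp
  next
    case (Cons y m)
    have "\<phi> (p @ x # y # (m @ x # q)) = - \<phi> (p @ y # x # (m @ x # q))"
      by (rule adjacent_swap[OF assms(1)]) (use Cons.prems adj in auto)
    also have "\<phi> (p @ y # x # (m @ x # q)) = \<phi> ((p @ [y]) @ x # m @ x # q)" by simp
    also have "\<dots> = 0" by (rule Cons.IH) (use Cons.prems in auto)
    finally show ?case by simp
  qed
  note * = this
  have "\<phi> vs = 0" if "length vs = k" "i < j" "j < k" "vs ! i = vs ! j" for vs i j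
  proof -
    have "vs = take i vs @ vs ! i # take (j - Suc i) (drop (Suc i) vs) @ vs ! j # drop (Suc j) vs"
      using that id_take_nth_drop[of i vs] id_take_nth_drop[of "j - Suc i" "drop (Suc i) vs"]
      by simp
    then show ?thesis
      using *[of "take i vs" "take (j - Suc i) (drop (Suc i) vs)" "drop (Suc j) vs" "vs ! i"] that
      by (simp add: min_absorb2)
  qed
  then show ?thesis using assms(1) unfolding alternating_def by blast
qed

lemma alternating_adjacentD:
  assumes "alternating k \<phi>" "length p + length q + 2 = k"
  shows "\<phi> (p @ x # x # q) = 0"
proof -
  have "length (p @ x # x # q) = k" "length p < Suc (length p)" "Suc (length p) < k"
    "(p @ x # x # q) ! length p = (p @ x # x # q) ! Suc (length p)"
    using assms(2) by (simp_all add: nth_append)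
  then show ?thesis using assms(1) unfolding alternating_def by blast
qed

lemma alternating_move:
  assumes "alternating k \<phi>" "length p + length q + length r + 1 = k"
  shows "\<phi> (p @ q @ x # r) = (-1) ^ length q * \<phi> (p @ x # q @ r)"
  using assms(2)
proof (induction q arbitrary: p)
  case Nil
  then show ?case by simp
next
  case (Cons y q)
  have "\<phi> (p @ (y # q) @ x # r) = (-1) ^ length q * \<phi> (p @ y # x # q @ r)"
    using Cons.IH[of "p @ [y]"] Cons.prems by simp
  also have "\<phi> (p @ y # x # (q @ r)) = - \<phi> (p @ x # y # (q @ r))"
    using assms(1) Cons.prems alternating_adjacentD[OF assms(1)]
    by (intro adjacent_swap[where k = k]) (auto simp: alternating_def)
  finally show ?case by simp
qed

text \<open>
  Substituting \<open>b i j\<close> for the \<open>j\<close>-th argument after deleting the \<open>i\<close>-th one, or for the \<open>i\<close>-th after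
  deleting the \<open>j\<close>-th, gives lists that differ by moving one entry across \<open>\<bar>i - j\<bar> - 1\<close> others. With
  the alternating signs these two contributions are opposite.
\<close>

lemma alternating_sum_symmetric_insertion:
  fixes ws :: "'v::real_vector list"
  assumes "alternating k \<phi>" and len: "length ws = Suc k" and sym: "\<And>i j. b i j = b j i"
  shows "(\<Sum>i<Suc k. (-1) ^ i *
      (\<Sum>j<k. \<phi> ((del_nth i ws)[j := b i (if j < i then j else Suc j)]))) = 0"
proof -
  define G where "G i j = (if i = j then 0 else
      (-1) ^ i * \<phi> ((del_nth i ws)[(if j < i then j else j - 1) := b i j]))" for i j
  have anti_less: "G i j = - G j i" if "i < j" "j < Suc k" for i j
  proof -
    define p m r where "p = take i ws" "m = take (j - Suc i) (drop (Suc i) ws)" "r = drop (Suc j) ws"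
    have ws: "ws = p @ ws ! i # m @ ws ! j # r"
      using that len id_take_nth_drop[of i ws] id_take_nth_drop[of "j - Suc i" "drop (Suc i) ws"]
      by (simp add: p_m_r_def)
    have lens: "length p = i" "length m = j - Suc i" "length p + length m + length r + 1 = k"
      using that len by (simp_all add: p_m_r_def)
    have di: "del_nth i ws = p @ m @ ws ! j # r"
      by (subst ws) (simp add: del_nth_def lens)
    have dj: "del_nth j ws = p @ ws ! i # m @ r"
    proof -
      have "j = Suc (length p + length m)" using lens that by simp
      then show ?thesis by (subst ws) (simp add: del_nth_def)
    qed
    have ui: "(del_nth i ws)[j - 1 := b i j] = p @ m @ b i j # r"
    proof -
      have "j = Suc (length p + length m)" using lens that by simp
      then show ?thesis by (simp add: di list_update_append)
    qed
    have uj: "(del_nth j ws)[i := b j i] = p @ b i j # m @ r"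
      using lens by (simp add: dj list_update_append sym[of j i])
    have "j = i + 1 + length m" using lens that by simp
    then have "(-1 :: real) ^ j = - ((-1) ^ i * (-1) ^ length m)"
      by (simp add: power_add)
    moreover have "\<phi> (p @ m @ b i j # r) = (-1) ^ length m * \<phi> (p @ b i j # m @ r)"
      by (rule alternating_move[OF assms(1)]) (use lens in auto)
    ultimately show ?thesis using that ui uj by (simp add: G_def)
  qed
  have anti: "G i j = - G j i" if "i < Suc k" "j < Suc k" for i j
    using anti_less[of i j] anti_less[of j i] that by (cases i j rule: linorder_cases) (auto simp: G_def)
  have inner: "(-1) ^ i * (\<Sum>j<k. \<phi> ((del_nth i ws)[j := b i (if j < i then j else Suc j)])) =
      (\<Sum>j<Suc k. G i j)" if "i < Suc k" for i
  proof -
    have "(\<Sum>j<Suc k. G i j) = (\<Sum>j\<in>{..<Suc k} - {i}. G i j)"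
      using that by (intro sum.mono_neutral_right) (auto simp: G_def)
    also have "\<dots> = (\<Sum>j<k. (-1) ^ i * \<phi> ((del_nth i ws)[j := b i (if j < i then j else Suc j)]))"
      using that
      by (intro sum.reindex_bij_witness[of _ "\<lambda>j. if j < i then j else Suc j"
            "\<lambda>j. if j < i then j else j - 1"]) (auto simp: G_def)
    finally show ?thesis by (simp add: sum_distrib_left)
  qed
  have "(\<Sum>i<Suc k. \<Sum>j<Suc k. G i j) = (\<Sum>i<Suc k. \<Sum>j<Suc k. G j i)"
    by (rule sum.swap)
  also have "\<dots> = - (\<Sum>i<Suc k. \<Sum>j<Suc k. G i j)"
    unfolding sum_negf[symmetric] by (intro sum.cong refl anti) auto
  finally have "(\<Sum>i<Suc k. \<Sum>j<Suc k. G i j) = 0" by simp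
  then show ?thesis using inner by simp
qed

section \<open>Differentiating alternating multilinear functions of lists\<close>

lemma linear_basis_expansion:
  fixes f :: "'e::euclidean_space \<Rightarrow> real"
  assumes "linear f"
  shows "f w = (\<Sum>e\<in>Basis. (w \<bullet> e) * f e)"
proof -
  have "f w = f (\<Sum>e\<in>Basis. (w \<bullet> e) *\<^sub>R e)" by (simp add: euclidean_representation)
  also have "\<dots> = (\<Sum>e\<in>Basis. (w \<bullet> e) * f e)"
    by (simp add: linear_sum[OF assms] linear_scale[OF assms])
  finally show ?thesis .
qed

text \<open>
  Multilinearity is an identity between functions of the base point near \<open>y\<close>, so it can be
  differentiated.
\<close>

lemma multilinear_frechet_derivative:
  fixes h :: "'b::real_normed_vector \<Rightarrow> 'e::real_vector list \<Rightarrow> real"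
  assumes "open W" "y \<in> W" and ml: "\<And>z. z \<in> W \<Longrightarrow> multilinear k (h z)"
    and diff: "\<And>us. length us = k \<Longrightarrow> (\<lambda>z. h z us) differentiable (at y)"
  shows "multilinear k (\<lambda>us. frechet_derivative (\<lambda>z. h z us) (at y) t)"
  unfolding multilinear_def
proof (intro allI impI linearI)
  fix us :: "'e list" and i assume us: "length us = k" "i < k"
  have der: "((\<lambda>z. h z (us[i := v])) has_derivative
      frechet_derivative (\<lambda>z. h z (us[i := v])) (at y)) (at y)" for v
    using diff us by (simp flip: frechet_derivative_works)
  have lin: "linear (\<lambda>v. h z (us[i := v]))" if "z \<in> W" for z
    using ml[OF that] us by (simp add: multilinear_def)
  fix a b :: 'e and r :: real
  have "((\<lambda>z. h z (us[i := a + b])) has_derivative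
      (\<lambda>t. frechet_derivative (\<lambda>z. h z (us[i := a])) (at y) t +
           frechet_derivative (\<lambda>z. h z (us[i := b])) (at y) t)) (at y)"
    using has_derivative_add[OF der der]
    by (rule has_derivative_transform_within_open[OF _ assms(1,2)])
      (use lin linear_add in fastforce)
  from fun_cong[OF frechet_derivative_at[OF this]]
  show "frechet_derivative (\<lambda>z. h z (us[i := a + b])) (at y) t =
      frechet_derivative (\<lambda>z. h z (us[i := a])) (at y) t +
      frechet_derivative (\<lambda>z. h z (us[i := b])) (at y) t" by simp
  have "((\<lambda>z. h z (us[i := r *\<^sub>R a])) has_derivative
      (\<lambda>t. r *\<^sub>R frechet_derivative (\<lambda>z. h z (us[i := a])) (at y) t)) (at y)"
    using has_derivative_scaleR_right[OF der]
    by (rule has_derivative_transform_within_open[OF _ assms(1,2)])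
      (use lin linear_scale in fastforce)
  from fun_cong[OF frechet_derivative_at[OF this]]
  show "frechet_derivative (\<lambda>z. h z (us[i := r *\<^sub>R a])) (at y) t =
      r *\<^sub>R frechet_derivative (\<lambda>z. h z (us[i := a])) (at y) t" by simp
qed

text \<open>
  This is what differentiating the transformation law of a form requires, where the base point and
  all arguments move with \<open>z\<close>. The arguments are set in motion one at a time: expanding the last
  moving argument in a basis leaves finitely many products of a coordinate function and an expression
  with one moving argument fewer, and multilinearity collapses the resulting sums again.
\<close>

lemma multilinear_chain_rule:
  fixes h :: "'b::real_normed_vector \<Rightarrow> 'e::euclidean_space list \<Rightarrow> real"
    and \<tau> :: "'v::real_normed_vector \<Rightarrow> 'b"
  assumes "open W" and ml: "\<And>y. y \<in> W \<Longrightarrow> multilinear k (h y)"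
    and diff: "\<And>us. length us = k \<Longrightarrow> (\<lambda>y. h y us) differentiable (at (\<tau> z0))"
    and "open U" "z0 \<in> U" and UW: "\<And>z. z \<in> U \<Longrightarrow> \<tau> z \<in> W"
    and \<tau>': "(\<tau> has_derivative \<tau>') (at z0)"
    and w': "\<And>j. j < m \<Longrightarrow> (w j has_derivative w' j) (at z0)"
    and "m + length cs = k"
  shows "((\<lambda>z. h (\<tau> z) (map (\<lambda>j. w j z) [0..<m] @ cs)) has_derivative
     (\<lambda>v. frechet_derivative (\<lambda>y. h y (map (\<lambda>j. w j z0) [0..<m] @ cs)) (at (\<tau> z0)) (\<tau>' v) +
          (\<Sum>j<m. h (\<tau> z0) ((map (\<lambda>j. w j z0) [0..<m] @ cs)[j := w' j v])))) (at z0)"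
  using w' \<open>m + length cs = k\<close>
proof (induction m arbitrary: cs)
  case 0
  have "((\<lambda>y. h y cs) has_derivative frechet_derivative (\<lambda>y. h y cs) (at (\<tau> z0))) (at (\<tau> z0))"
    using diff 0 by (simp flip: frechet_derivative_works)
  from has_derivative_compose[OF \<tau>' this] show ?case by simp
next
  case (Suc m)
  define ws where "ws z = map (\<lambda>j. w j z) [0..<m]" for z
  have len: "length (ws z) = m" for z by (simp add: ws_def)
  define D where "D us = frechet_derivative (\<lambda>y. h y us) (at (\<tau> z0))" for us
  have "\<tau> z0 \<in> W" using UW \<open>z0 \<in> U\<close> by blast
  have mlD: "multilinear k (\<lambda>us. D us t)" for t
    unfolding D_def by (rule multilinear_frechet_derivative[OF \<open>open W\<close> \<open>\<tau> z0 \<in> W\<close> ml diff])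
  have exp_h: "h y (us @ x # cs) = (\<Sum>e\<in>Basis. (x \<bullet> e) * h y (us @ e # cs))"
    if "y \<in> W" "length us = m" for y us x
    using that Suc.prems(2)
    by (intro linear_basis_expansion multilinear_linear_append[OF ml]) auto
  have exp_D: "D (us @ x # cs) t = (\<Sum>e\<in>Basis. (x \<bullet> e) * D (us @ e # cs) t)"
    if "length us = m" for us x t
    using that Suc.prems(2)
    by (intro linear_basis_expansion multilinear_linear_append[OF mlD]) auto
  have IH: "((\<lambda>z. h (\<tau> z) (ws z @ e # cs)) has_derivative
     (\<lambda>v. D (ws z0 @ e # cs) (\<tau>' v) +
          (\<Sum>j<m. h (\<tau> z0) ((ws z0)[j := w' j v] @ e # cs)))) (at z0)" for e
    using Suc.IH[of "e # cs"] Suc.prems by (simp add: ws_def D_def list_update_append)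
  have wm: "(w m has_derivative w' m) (at z0)" using Suc.prems(1) by simp
  have "((\<lambda>z. \<Sum>e\<in>Basis. (w m z \<bullet> e) * h (\<tau> z) (ws z @ e # cs)) has_derivative
     (\<lambda>v. \<Sum>e\<in>Basis. (w m z0 \<bullet> e) * (D (ws z0 @ e # cs) (\<tau>' v) +
          (\<Sum>j<m. h (\<tau> z0) ((ws z0)[j := w' j v] @ e # cs))) +
          (w' m v \<bullet> e) * h (\<tau> z0) (ws z0 @ e # cs))) (at z0)"
    by (intro has_derivative_sum has_derivative_mult has_derivative_inner_left wm IH)
  then have "((\<lambda>z. h (\<tau> z) (ws z @ w m z # cs)) has_derivative
     (\<lambda>v. \<Sum>e\<in>Basis. (w m z0 \<bullet> e) * (D (ws z0 @ e # cs) (\<tau>' v) +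
          (\<Sum>j<m. h (\<tau> z0) ((ws z0)[j := w' j v] @ e # cs))) +
          (w' m v \<bullet> e) * h (\<tau> z0) (ws z0 @ e # cs))) (at z0)"
    by (rule has_derivative_transform_within_open[OF _ \<open>open U\<close> \<open>z0 \<in> U\<close>])
      (simp add: exp_h[OF UW len, symmetric])
  also have "(\<lambda>v. \<Sum>e\<in>Basis. (w m z0 \<bullet> e) * (D (ws z0 @ e # cs) (\<tau>' v) +
          (\<Sum>j<m. h (\<tau> z0) ((ws z0)[j := w' j v] @ e # cs))) +
          (w' m v \<bullet> e) * h (\<tau> z0) (ws z0 @ e # cs)) =
     (\<lambda>v. D (ws z0 @ w m z0 # cs) (\<tau>' v) +
          (\<Sum>j<m. h (\<tau> z0) ((ws z0)[j := w' j v] @ w m z0 # cs)) +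
          h (\<tau> z0) (ws z0 @ w' m v # cs))"
  proof
    fix v
    have "(\<Sum>j<m. h (\<tau> z0) ((ws z0)[j := w' j v] @ w m z0 # cs)) =
        (\<Sum>j<m. \<Sum>e\<in>Basis. (w m z0 \<bullet> e) * h (\<tau> z0) ((ws z0)[j := w' j v] @ e # cs))"
      by (intro sum.cong refl exp_h \<open>\<tau> z0 \<in> W\<close>) (simp add: len)
    also have "\<dots> = (\<Sum>e\<in>Basis. (w m z0 \<bullet> e) *
          (\<Sum>j<m. h (\<tau> z0) ((ws z0)[j := w' j v] @ e # cs)))"
      by (subst sum.swap) (simp add: sum_distrib_left)
    finally show "(\<Sum>e\<in>Basis. (w m z0 \<bullet> e) * (D (ws z0 @ e # cs) (\<tau>' v) +
          (\<Sum>j<m. h (\<tau> z0) ((ws z0)[j := w' j v] @ e # cs))) +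
          (w' m v \<bullet> e) * h (\<tau> z0) (ws z0 @ e # cs)) =
        D (ws z0 @ w m z0 # cs) (\<tau>' v) +
          (\<Sum>j<m. h (\<tau> z0) ((ws z0)[j := w' j v] @ w m z0 # cs)) +
          h (\<tau> z0) (ws z0 @ w' m v # cs)"
      by (simp only: exp_D[OF len, where x = "w m z0"] exp_h[OF \<open>\<tau> z0 \<in> W\<close> len, where x = "w' m v"] sum.distrib distrib_left)
  qed
  also have "\<dots> = (\<lambda>v. D (ws z0 @ w m z0 # cs) (\<tau>' v) +
      (\<Sum>j<Suc m. h (\<tau> z0) ((ws z0 @ w m z0 # cs)[j := w' j v])))"
  proof -
    have "(ws z0 @ w m z0 # cs)[m := x] = ws z0 @ x # cs" for x
      using list_update_length[of "ws z0" "w m z0" cs x] by (simp add: len)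
    then show ?thesis by (auto simp: list_update_append len add.assoc)
  qed
  finally show ?case by (simp add: ws_def D_def)
qed

section \<open>Charts and transition maps\<close>

lemma cimg_open: "smooth_manifold M A \<Longrightarrow> c \<in> A \<Longrightarrow> open (cimg c)"
  by (simp add: smooth_manifold_def)

lemma cmap_in_cimg: "x \<in> cdom c \<Longrightarrow> cmap c x \<in> cimg c"
  by (simp add: cimg_def)

lemma chart_homeomorphic:
  "smooth_manifold M A \<Longrightarrow> c \<in> A \<Longrightarrow>
   homeomorphic_map (subtopology M (cdom c)) (top_of_set (cimg c)) (cmap c)"
  by (simp add: smooth_manifold_def)

lemma chart_domain_open: "smooth_manifold M A \<Longrightarrow> c \<in> A \<Longrightarrow> openin M (cdom c)"
  by (simp add: smooth_manifold_def)

lemma overlap_open: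
  assumes "smooth_manifold M A" "c \<in> A" "c' \<in> A"
  shows "open (cmap c ` (cdom c \<inter> cdom c'))"
proof -
  have "openin (subtopology M (cdom c)) (cdom c \<inter> cdom c')"
    using chart_domain_open[OF assms(1,3)] openin_subtopology_Int2 by metis
  then have "openin (top_of_set (cimg c)) (cmap c ` (cdom c \<inter> cdom c'))"
    using homeomorphic_imp_open_map[OF chart_homeomorphic[OF assms(1,2)]]
    by (simp add: open_map_def)
  then show ?thesis using cimg_open[OF assms(1,2)] openin_open_trans by blast
qed

lemma transition_cmap:
  assumes "smooth_manifold M A" "c \<in> A" "x \<in> cdom c"
  shows "transition c c' (cmap c x) = cmap c' x"
proof -
  have "inj_on (cmap c) (topspace (subtopology M (cdom c)))"
    using homeomorphic_imp_injective_map[OF chart_homeomorphic[OF assms(1,2)]] .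
  moreover have "topspace (subtopology M (cdom c)) = cdom c"
    using openin_subset[OF chart_domain_open[OF assms(1,2)]] by auto
  ultimately show ?thesis using assms(3) by (simp add: transition_def)
qed

lemma transition_smooth:
  "smooth_manifold M A \<Longrightarrow> c \<in> A \<Longrightarrow> c' \<in> A \<Longrightarrow>
   smooth_on (cmap c ` (cdom c \<inter> cdom c')) (transition c c')"
  by (simp add: smooth_manifold_def)

lemma transition_has_derivative:
  assumes "smooth_manifold M A" "c \<in> A" "c' \<in> A" "x \<in> cdom c \<inter> cdom c'"
  shows "(transition c c' has_derivative transition_deriv c c' x) (at (cmap c x))"
  unfolding transition_deriv_def
  by (rule smooth_on_has_derivative[OF transition_smooth[OF assms(1-3)]]) (use assms(4) in blast)

text \<open>By the chain rule, the derivative of the inverse transition is a left inverse.\<close>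

lemma transition_deriv_det:
  assumes "smooth_manifold M A" "c \<in> A" "c' \<in> A" "x \<in> cdom c \<inter> cdom c'"
  shows "det (matrix (transition_deriv c c' x)) \<noteq> 0"
proof -
  let ?L = "transition_deriv c c' x" and ?L' = "transition_deriv c' c x"
  have L: "(transition c c' has_derivative ?L) (at (cmap c x))"
    using transition_has_derivative[OF assms] .
  have L': "(transition c' c has_derivative ?L') (at (cmap c' x))"
    using transition_has_derivative[OF assms(1,3,2)] assms(4) by blast
  have "transition c c' (cmap c x) = cmap c' x"
    using transition_cmap[OF assms(1,2)] assms(4) by blast
  then have "((\<lambda>z. transition c' c (transition c c' z)) has_derivative (\<lambda>v. ?L' (?L v))) (at (cmap c x))"
    using has_derivative_compose[OF L, of "transition c' c" ?L'] L' by simp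
  then have "((\<lambda>z. z) has_derivative (\<lambda>v. ?L' (?L v))) (at (cmap c x))"
    by (rule has_derivative_transform_within_open[OF _ overlap_open[OF assms(1-3)]])
      (use assms in \<open>auto simp: transition_cmap\<close>)
  then have "(\<lambda>v. ?L' (?L v)) = (\<lambda>v. v)"
    using has_derivative_ident has_derivative_unique by blast
  then have "?L' \<circ> ?L = id" by (auto simp: fun_eq_iff)
  then have "matrix ?L' ** matrix ?L = mat 1"
    using matrix_compose[OF has_derivative_linear[OF L] has_derivative_linear[OF L']]
    by (simp add: matrix_id_mat_1)
  then have "det (matrix ?L') * det (matrix ?L) = 1"
    by (metis det_I det_mul)
  then show ?thesis by auto
qed


section \<open>The kernel of a product of shifts of an operator\<close>

text \<open>
  The operator is linear only on the subspace \<open>V\<close>: a differential operator on forms makes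
  no sense on arbitrary families of local representatives.
\<close>

locale operator_on_subspace = vector_space +
  fixes V :: "'b set" and T :: "'b \<Rightarrow> 'b"
  assumes subspace_V: "subspace V"
    and T_closed: "f \<in> V \<Longrightarrow> T f \<in> V"
    and T_add: "f \<in> V \<Longrightarrow> h \<in> V \<Longrightarrow> T (f + h) = T f + T h"
    and T_scale: "f \<in> V \<Longrightarrow> T (c *s f) = c *s T f"
begin

primrec shift_product :: "(nat \<Rightarrow> 'a) \<Rightarrow> nat \<Rightarrow> 'b \<Rightarrow> 'b" where
  "shift_product l 0 f = f"
| "shift_product l (Suc m) f = T (shift_product l m f) - l m *s shift_product l m f"

definition eigenspace :: "'a \<Rightarrow> 'b set" where
  "eigenspace c = {f \<in> V. T f = c *s f}"

lemma T_diff: "f \<in> V \<Longrightarrow> h \<in> V \<Longrightarrow> T (f - h) = T f - T h"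
  using T_add[of f "(-1) *s h"] T_scale[of h "-1"] subspace_scale[OF subspace_V, of h "-1"]
  by simp

lemma T_zero: "T 0 = 0"
  using T_scale[of 0 0] subspace_0[OF subspace_V] by simp

lemma T_sum: "(\<And>i. i \<in> I \<Longrightarrow> w i \<in> V) \<Longrightarrow> T (\<Sum>i\<in>I. w i) = (\<Sum>i\<in>I. T (w i))"
  by (induction I rule: infinite_finite_induct)
    (auto simp: T_zero T_add subspace_sum[OF subspace_V])

lemma shift_closed: "f \<in> V \<Longrightarrow> T f - c *s f \<in> V"
  by (intro subspace_diff[OF subspace_V] T_closed subspace_scale[OF subspace_V])

lemma shift_product_closed: "f \<in> V \<Longrightarrow> shift_product l m f \<in> V"
  by (induction m) (auto intro: shift_closed)

lemma shift_product_add: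
  "f \<in> V \<Longrightarrow> h \<in> V \<Longrightarrow> shift_product l m (f + h) = shift_product l m f + shift_product l m h"
  by (induction m) (auto simp: T_add shift_product_closed scale_right_distrib)

lemma shift_product_zero: "shift_product l m 0 = 0"
  by (induction m) (auto simp: T_zero)

lemma shift_product_sum:
  "(\<And>i. i \<in> I \<Longrightarrow> w i \<in> V) \<Longrightarrow> shift_product l m (\<Sum>i\<in>I. w i) = (\<Sum>i\<in>I. shift_product l m (w i))"
  by (induction I rule: infinite_finite_induct)
    (auto simp: shift_product_zero shift_product_add subspace_sum[OF subspace_V])

lemma shift_product_commute:
  assumes "f \<in> V"
  shows "shift_product l m (T f - c *s f) = T (shift_product l m f) - c *s shift_product l m f"
proof (induction m)
  case (Suc m)
  have "shift_product l m f \<in> V" "T (shift_product l m f) \<in> V"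
    using assms by (auto intro: shift_product_closed T_closed)
  then show ?case
    by (simp add: Suc T_diff T_scale subspace_scale[OF subspace_V] scale_right_diff_distrib
        mult.commute algebra_simps)
qed simp

lemma shift_product_Suc_left:
  "shift_product l (Suc m) f = shift_product (\<lambda>i. l (Suc i)) m (T f - l 0 *s f)"
  by (induction m) simp_all

lemma shift_product_eigenvector:
  assumes "f \<in> eigenspace c"
  shows "shift_product l m f = (\<Prod>i<m. c - l i) *s f"
  using assms by (induction m) (auto simp: eigenspace_def T_scale scale_left_diff_distrib algebra_simps)

lemma eigenspace_scale: "f \<in> eigenspace c \<Longrightarrow> a *s f \<in> eigenspace c"
  by (auto simp: eigenspace_def subspace_scale[OF subspace_V] T_scale scale_left_commute)

text \<open>
  Applying \<open>T - l\<^sub>m\<close> to a vanishing sum of eigenvectors kills the last summand and multiplies each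
  other one by the nonzero number \<open>l\<^sub>i - l\<^sub>m\<close>.
\<close>

lemma eigenvectors_independent:
  fixes m :: nat
  assumes "inj_on l {..<m}" "\<And>i. i < m \<Longrightarrow> w i \<in> eigenspace (l i)" "(\<Sum>i<m. w i) = 0" "i < m"
  shows "w i = 0"
  using assms
proof (induction m arbitrary: w i)
  case (Suc m)
  have V: "w i \<in> V" "T (w i) = l i *s w i" if "i < Suc m" for i
    using Suc.prems(2)[OF that] by (auto simp: eigenspace_def)
  have "(\<Sum>i<m. (l i - l m) *s w i) = (\<Sum>i<Suc m. T (w i) - l m *s w i)"
    using V by (simp add: scale_left_diff_distrib)
  also have "\<dots> = T (\<Sum>i<Suc m. w i) - l m *s (\<Sum>i<Suc m. w i)"
    using V T_sum[of "{..<Suc m}" w] by (simp add: sum_subtractf scale_sum_right del: sum.lessThan_Suc)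
  also have "\<dots> = 0"
    using Suc.prems(3) by (simp add: T_zero del: sum.lessThan_Suc)
  finally have "(l i - l m) *s w i = 0" if "i < m" for i
    using Suc.IH[of "\<lambda>i. (l i - l m) *s w i" i] that Suc.prems(1,2) eigenspace_scale
    by (simp add: inj_on_def)
  then have low: "w i = 0" if "i < m" for i
    using that Suc.prems(1) by (force simp: inj_on_def)
  then have "w m = 0" using Suc.prems(3) by simp
  then show ?case using low Suc.prems(4) by (cases "i = m") auto
qed simp

text \<open>
  If \<open>f\<close> is in the kernel, decompose \<open>(T - l\<^sub>m) f\<close> by induction into eigenvectors \<open>w\<^sub>i\<close>; dividing
  them by \<open>l\<^sub>i - l\<^sub>m\<close> gives a sum of eigenvectors that differs from \<open>f\<close> by an eigenvector for \<open>l\<^sub>m\<close>.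
\<close>

lemma eigenvector_decomposition:
  assumes "inj_on l {..<m}" "f \<in> V" "shift_product l m f = 0"
  shows "\<exists>w. (\<forall>i<m. w i \<in> eigenspace (l i)) \<and> f = (\<Sum>i<m. w i)"
  using assms
proof (induction m arbitrary: f)
  case (Suc m)
  have "shift_product l m (T f - l m *s f) = 0"
    using Suc.prems by (simp add: shift_product_commute)
  then obtain w where w: "\<And>i. i < m \<Longrightarrow> w i \<in> eigenspace (l i)" "T f - l m *s f = (\<Sum>i<m. w i)"
    using Suc.IH[of "T f - l m *s f"] Suc.prems(1,2) shift_closed
    by (auto simp: inj_on_def)
  define v where "v i = inverse (l i - l m) *s w i" for i
  have v: "v i \<in> eigenspace (l i)" if "i < m" for i
    using w(1)[OF that] by (simp add: v_def eigenspace_scale)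
  then have vV: "v i \<in> V" if "i < m" for i
    using that by (simp add: eigenspace_def)
  have wv: "T (v i) - l m *s v i = w i" if "i < m" for i
  proof -
    have "l i - l m \<noteq> 0" using that Suc.prems(1) by (force simp: inj_on_def)
    moreover have "T (v i) - l m *s v i = (l i - l m) *s v i"
      using v[OF that] by (simp add: eigenspace_def scale_left_diff_distrib)
    ultimately show ?thesis by (simp add: v_def)
  qed
  let ?s = "\<Sum>i<m. v i"
  have "T ?s - l m *s ?s = (\<Sum>i<m. T (v i) - l m *s v i)"
    using T_sum[of "{..<m}" v] vV by (simp add: scale_sum_right sum_subtractf)
  also have "\<dots> = T f - l m *s f" using wv w(2) by simp
  finally have s: "T ?s - l m *s ?s = T f - l m *s f" .
  have sV: "?s \<in> V" using vV by (auto intro: subspace_sum[OF subspace_V])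
  have "f - ?s \<in> eigenspace (l m)"
    using s sV Suc.prems(2)
    by (simp add: eigenspace_def subspace_diff[OF subspace_V] T_diff scale_right_diff_distrib
        algebra_simps)
  then have "\<forall>i<Suc m. (v(m := f - ?s)) i \<in> eigenspace (l i)"
    using v by (auto simp: less_Suc_eq)
  moreover have "f = (\<Sum>i<Suc m. (v(m := f - ?s)) i)" by simp
  ultimately show ?case by blast
qed simp

lemma kernel_shift_product:
  assumes "inj_on l {..<m}"
  shows "is_direct_sum {f \<in> V. shift_product l m f = 0} {..<m} (\<lambda>i. eigenspace (l i))"
  unfolding is_direct_sum_def
proof (intro conjI bij_betw_imageI)
  have VV: "eigenspace c \<subseteq> V" for c by (auto simp: eigenspace_def)
  show "inj_on (\<lambda>w. \<Sum>i<m. w i) (\<Pi>\<^sub>E i\<in>{..<m}. eigenspace (l i))"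
  proof (rule inj_onI)
    fix w w' assume *: "w \<in> (\<Pi>\<^sub>E i\<in>{..<m}. eigenspace (l i))"
      "w' \<in> (\<Pi>\<^sub>E i\<in>{..<m}. eigenspace (l i))" "(\<Sum>i<m. w i) = (\<Sum>i<m. w' i)"
    have "w i - w' i \<in> eigenspace (l i)" if "i < m" for i
      using PiE_mem[OF *(1), of i] PiE_mem[OF *(2), of i] that
      by (auto simp: eigenspace_def subspace_diff[OF subspace_V] T_diff scale_right_diff_distrib)
    then have "w i - w' i = 0" if "i < m" for i
      using eigenvectors_independent[OF assms, of "\<lambda>i. w i - w' i"] *(3) that
      by (simp add: sum_subtractf)
    then show "w = w'" using *(1,2) by (intro PiE_ext) auto
  qed
  show "(\<lambda>w. \<Sum>i<m. w i) ` (\<Pi>\<^sub>E i\<in>{..<m}. eigenspace (l i)) = {f \<in> V. shift_product l m f = 0}"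
  proof (intro equalityI subsetI)
    fix f assume "f \<in> (\<lambda>w. \<Sum>i<m. w i) ` (\<Pi>\<^sub>E i\<in>{..<m}. eigenspace (l i))"
    then obtain w where w: "\<And>i. i < m \<Longrightarrow> w i \<in> eigenspace (l i)" "f = (\<Sum>i<m. w i)"
      by auto
    have V: "w i \<in> V" if "i < m" for i using w(1)[OF that] VV by blast
    have "shift_product l m (w i) = 0" if "i < m" for i
      using that by (auto simp: shift_product_eigenvector[OF w(1)] prod_zero_iff)
    then show "f \<in> {f \<in> V. shift_product l m f = 0}"
      using V shift_product_sum[of "{..<m}" w l m] subspace_sum[OF subspace_V, of "{..<m}" w]
      by (simp add: w(2))
  next
    fix f assume "f \<in> {f \<in> V. shift_product l m f = 0}"
    then obtain w where w: "\<And>i. i < m \<Longrightarrow> w i \<in> eigenspace (l i)" "f = (\<Sum>i<m. w i)"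
      using eigenvector_decomposition[OF assms] by blast
    then have "restrict w {..<m} \<in> (\<Pi>\<^sub>E i\<in>{..<m}. eigenspace (l i))" "f = (\<Sum>i<m. restrict w {..<m} i)"
      by auto
    then show "f \<in> (\<lambda>w. \<Sum>i<m. w i) ` (\<Pi>\<^sub>E i\<in>{..<m}. eigenspace (l i))" by blast
  qed
qed simp

end

section \<open>The exterior derivative of a form is a form\<close>

text \<open>
  The density factor of weight \<open>0\<close> drops out because transition derivatives are invertible
  (\<open>0 powr 0\<close> would be \<open>0\<close>).
\<close>

lemma mem_forms_iff:
  fixes A :: "('a, 'n::finite) chart set"
  assumes "smooth_manifold M A"
  shows "\<omega> \<in> forms A k \<longleftrightarrow>
     (\<forall>c y vs. \<not> (c \<in> A \<and> y \<in> cimg c \<and> length vs = k) \<longrightarrow> \<omega> c y vs = 0) \<and>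
     (\<forall>c\<in>A. \<forall>y\<in>cimg c. alternating k (\<omega> c y)) \<and>
     (\<forall>c\<in>A. \<forall>vs. length vs = k \<longrightarrow> smooth_on (cimg c) (\<lambda>y. \<omega> c y vs)) \<and>
     (\<forall>c\<in>A. \<forall>c'\<in>A. \<forall>x\<in>cdom c \<inter> cdom c'. \<forall>vs. length vs = k \<longrightarrow>
        \<omega> c (cmap c x) vs = \<omega> c' (cmap c' x) (map (transition_deriv c c' x) vs))"
proof -
  have law: "(\<forall>c\<in>A. \<forall>c'\<in>A. \<forall>x\<in>cdom c \<inter> cdom c'. \<forall>vs. length vs = k \<longrightarrow>
        \<omega> c (cmap c x) vs =
        \<bar>det (matrix (transition_deriv c c' x))\<bar> powr (- 0 / real CARD('n)) *
        \<omega> c' (cmap c' x) (map (transition_deriv c c' x) vs)) \<longleftrightarrow>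
     (\<forall>c\<in>A. \<forall>c'\<in>A. \<forall>x\<in>cdom c \<inter> cdom c'. \<forall>vs. length vs = k \<longrightarrow>
        \<omega> c (cmap c x) vs = \<omega> c' (cmap c' x) (map (transition_deriv c c' x) vs))"
    using transition_deriv_det[OF assms] by (intro ball_cong refl) simp
  show ?thesis
    unfolding forms_def weighted_forms_def mem_Collect_eq law
    by (simp only: alternating_def multilinear_def ball_conj_distrib conj_assoc)
qed

locale atlas =
  fixes M :: "'a topology" and A :: "('a, 'n::finite) chart set"
  assumes manifold: "smooth_manifold M A"
begin

lemma forms_vanish:
  "\<omega> \<in> forms A k \<Longrightarrow> \<not> (c \<in> A \<and> y \<in> cimg c \<and> length vs = k) \<Longrightarrow> \<omega> c y vs = 0"
  unfolding mem_forms_iff[OF manifold] by blast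

lemma forms_alternating: "\<omega> \<in> forms A k \<Longrightarrow> c \<in> A \<Longrightarrow> y \<in> cimg c \<Longrightarrow> alternating k (\<omega> c y)"
  unfolding mem_forms_iff[OF manifold] by blast

lemma forms_multilinear: "\<omega> \<in> forms A k \<Longrightarrow> c \<in> A \<Longrightarrow> y \<in> cimg c \<Longrightarrow> multilinear k (\<omega> c y)"
  using forms_alternating alternating_def by blast

lemma forms_transform:
  "\<omega> \<in> forms A k \<Longrightarrow> c \<in> A \<Longrightarrow> c' \<in> A \<Longrightarrow> x \<in> cdom c \<inter> cdom c' \<Longrightarrow> length vs = k \<Longrightarrow>
   \<omega> c (cmap c x) vs = \<omega> c' (cmap c' x) (map (transition_deriv c c' x) vs)"
  unfolding mem_forms_iff[OF manifold] by blast

lemma forms_smooth: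
  assumes "\<omega> \<in> forms A k" "c \<in> A"
  shows "smooth_on (cimg c) (\<lambda>y. \<omega> c y vs)"
proof (cases "length vs = k")
  case True
  then show ?thesis using assms unfolding mem_forms_iff[OF manifold] by blast
next
  case False
  then have "(\<lambda>y. \<omega> c y vs) = (\<lambda>y. 0)" using forms_vanish[OF assms(1)] by auto
  then show ?thesis by (simp add: smooth_on_const)
qed

lemma forms_has_derivative:
  "\<omega> \<in> forms A k \<Longrightarrow> c \<in> A \<Longrightarrow> y \<in> cimg c \<Longrightarrow>
   ((\<lambda>z. \<omega> c z vs) has_derivative frechet_derivative (\<lambda>z. \<omega> c z vs) (at y)) (at y)"
  using smooth_on_has_derivative forms_smooth by blast

lemma ext_deriv_eq:
  "c \<in> A \<Longrightarrow> y \<in> cimg c \<Longrightarrow> ext_deriv A \<omega> c y vs =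
   (\<Sum>i<length vs. (-1) ^ i * frechet_derivative (\<lambda>z. \<omega> c z (del_nth i vs)) (at y) (vs ! i))"
  by (simp add: ext_deriv_def del_nth_def)

lemma ext_deriv_vanish:
  assumes "\<omega> \<in> forms A k" "\<not> (c \<in> A \<and> y \<in> cimg c \<and> length vs = Suc k)"
  shows "ext_deriv A \<omega> c y vs = 0"
proof (cases "c \<in> A \<and> y \<in> cimg c")
  case True
  have "(\<lambda>z. \<omega> c z (del_nth i vs)) = (\<lambda>z. 0)" if "i < length vs" for i
    using that assms True by (intro ext forms_vanish[OF assms(1)]) auto
  then show ?thesis using True by (simp add: ext_deriv_eq)
qed (auto simp: ext_deriv_def)

lemma ext_deriv_multilinear:
  assumes "\<omega> \<in> forms A k" "c \<in> A" "y \<in> cimg c"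
  shows "multilinear (Suc k) (ext_deriv A \<omega> c y)"
  unfolding multilinear_def
proof (intro allI impI)
  fix vs :: "(real^'n) list" and j assume vs: "length vs = Suc k" "j < Suc k"
  have "linear (\<lambda>v. frechet_derivative (\<lambda>z. \<omega> c z (del_nth i (vs[j := v]))) (at y) (vs[j := v] ! i))"
    if "i < Suc k" for i
  proof (cases "i = j")
    case True
    then show ?thesis
      using vs has_derivative_linear[OF forms_has_derivative[OF assms, of "del_nth j vs"]]
      by (simp add: del_nth_update_same)
  next
    case False
    have "multilinear k (\<lambda>us. frechet_derivative (\<lambda>z. \<omega> c z us) (at y) (vs ! i))"
    proof (rule multilinear_frechet_derivative[OF cimg_open[OF manifold assms(2)] assms(3)])
      show "multilinear k (\<omega> c z)" if "z \<in> cimg c" for z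
        using forms_multilinear assms(1,2) that .
      show "(\<lambda>z. \<omega> c z us) differentiable (at y)" for us
        using forms_has_derivative[OF assms] by (rule differentiableI)
    qed
    then have "linear (\<lambda>v. frechet_derivative
        (\<lambda>z. \<omega> c z ((del_nth i vs)[(if j < i then j else j - 1) := v])) (at y) (vs ! i))"
      unfolding multilinear_def using False vs that
      by (elim allE[of _ "del_nth i vs"] allE[of _ "if j < i then j else j - 1"]) auto
    then show ?thesis
      using False vs that by (simp add: del_nth_update)
  qed
  then have "linear (\<lambda>v. \<Sum>i<Suc k. (-1) ^ i *\<^sub>R
      frechet_derivative (\<lambda>z. \<omega> c z (del_nth i (vs[j := v]))) (at y) (vs[j := v] ! i))"
    by (intro linear_compose_sum ballI linear_compose_scale_right) auto
  then show "linear (\<lambda>v. ext_deriv A \<omega> c y (vs[j := v]))"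
    using vs assms by (simp add: ext_deriv_eq)
qed

text \<open>
  If two adjacent arguments agree, deleting either of them leaves the same list, with opposite
  signs, and deleting any other one leaves two equal arguments.
\<close>

lemma ext_deriv_alternating:
  assumes "\<omega> \<in> forms A k" "c \<in> A" "y \<in> cimg c"
  shows "alternating (Suc k) (ext_deriv A \<omega> c y)"
proof (rule alternating_adjacentI[OF ext_deriv_multilinear[OF assms]])
  fix p q :: "(real^'n) list" and x assume len: "length p + length q + 2 = Suc k"
  define vs where "vs = p @ x # x # q"
  define t where "t i = (-1) ^ i *
      frechet_derivative (\<lambda>z. \<omega> c z (del_nth i vs)) (at y) (vs ! i)" for i
  let ?a = "length p"
  have lvs: "length vs = Suc k" using len by (simp add: vs_def)
  have "t i = 0" if "i < Suc k" "i \<noteq> ?a" "i \<noteq> Suc ?a" for i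
  proof -
    have "\<omega> c z (del_nth i vs) = 0" if z: "z \<in> cimg c" for z
    proof (cases "i < ?a")
      case True
      then have "del_nth i vs = del_nth i p @ x # x # q" by (simp add: del_nth_def vs_def)
      then show ?thesis
        using alternating_adjacentD[OF forms_alternating[OF assms(1,2) z]] len True by simp
    next
      case False
      then have "i = Suc (Suc (?a + (i - Suc (Suc ?a))))" using that \<open>i \<noteq> ?a\<close> \<open>i \<noteq> Suc ?a\<close> by simp
      then obtain b where b: "i = Suc (Suc (?a + b))" by blast
      then have "del_nth i vs = p @ x # x # del_nth b q"
        by (simp add: del_nth_def vs_def numeral_eq_Suc)
      then show ?thesis
        using alternating_adjacentD[OF forms_alternating[OF assms(1,2) z]] len b \<open>i < Suc k\<close> by simp
    qed
    then have "((\<lambda>z. \<omega> c z (del_nth i vs)) has_derivative (\<lambda>v. 0)) (at y)"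
      by (intro has_derivative_transform_within_open[OF has_derivative_const cimg_open[OF manifold assms(2)] assms(3)]) simp
    from fun_cong[OF frechet_derivative_at[OF this]] show ?thesis by (simp add: t_def)
  qed
  then have "(\<Sum>i<Suc k. t i) = (\<Sum>i\<in>{?a, Suc ?a}. t i)"
    using len by (intro sum.mono_neutral_right) auto
  also have "\<dots> = 0"
    by (simp add: t_def vs_def del_nth_def nth_append)
  finally show "ext_deriv A \<omega> c y (p @ x # x # q) = 0"
    using assms lvs by (simp add: ext_deriv_eq t_def flip: vs_def)
qed

lemma ext_deriv_smooth:
  assumes "\<omega> \<in> forms A k" "c \<in> A"
  shows "smooth_on (cimg c) (\<lambda>y. ext_deriv A \<omega> c y vs)"
proof -
  have o: "open (cimg c)" using cimg_open[OF manifold assms(2)] .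
  have "smooth_on (cimg c) (\<lambda>y. \<Sum>i<length vs. (-1) ^ i *
      frechet_derivative (\<lambda>z. \<omega> c z (del_nth i vs)) (at y) (vs ! i))"
    using assms
    by (intro smooth_on_sum smooth_on_cmult smooth_on_directional_deriv forms_smooth o)
  then show ?thesis
    by (rule smooth_on_cong[OF o]) (use assms in \<open>simp add: ext_deriv_eq\<close>)
qed

text \<open>
  Differentiating the transformation law of \<open>\<omega>\<close> along \<open>v\<^sub>i\<close> also differentiates the pushed forward
  arguments; this gives the terms in which one of them, \<open>v\<^sub>j\<close>, is replaced by the second derivative of the
  transition map in the directions \<open>v\<^sub>i\<close>, \<open>v\<^sub>j\<close>. As the second derivative is symmetric, these terms
  cancel in the alternating sum over \<open>i\<close>.
\<close>

lemma ext_deriv_transform: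
  assumes "\<omega> \<in> forms A k" "c \<in> A" "c' \<in> A" "x \<in> cdom c \<inter> cdom c'" "length vs = Suc k"
  shows "ext_deriv A \<omega> c (cmap c x) vs =
         ext_deriv A \<omega> c' (cmap c' x) (map (transition_deriv c c' x) vs)"
proof -
  define \<tau> where "\<tau> = transition c c'"
  define U where "U = cmap c ` (cdom c \<inter> cdom c')"
  define z0 where "z0 = cmap c x"
  define L where "L z = frechet_derivative \<tau> (at z)" for z
  define B where "B v u = frechet_derivative (\<lambda>z. L z u) (at z0) v" for v u
  have U: "open U" "z0 \<in> U" using overlap_open[OF manifold assms(2,3)] assms(4)
    by (auto simp: U_def z0_def)
  have \<tau>: "smooth_on U \<tau>"
    using transition_smooth[OF manifold assms(2,3)] by (simp add: U_def \<tau>_def)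
  have \<tau>_cmap: "\<tau> (cmap c x) = cmap c' x" if "x \<in> cdom c" for x
    using transition_cmap[OF manifold assms(2) that] by (simp add: \<tau>_def)
  have \<tau>U: "\<tau> z \<in> cimg c'" if "z \<in> U" for z
    using that \<tau>_cmap cmap_in_cimg[of _ c'] by (auto simp: U_def)
  have B_sym: "B v u = B u v" for u v
    unfolding B_def L_def by (rule second_derivative_symmetric[OF U(1) \<tau> U(2)])
  have L': "((\<lambda>z. L z u) has_derivative (\<lambda>v. B v u)) (at z0)" for u
    unfolding B_def L_def
    by (rule smooth_on_has_derivative[OF smooth_on_directional_deriv[OF \<tau>] U(2)])
  have deriv: "frechet_derivative (\<lambda>z. \<omega> c z us) (at z0) v =
      frechet_derivative (\<lambda>y. \<omega> c' y (map (L z0) us)) (at (\<tau> z0)) (L z0 v) +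
      (\<Sum>j<k. \<omega> c' (\<tau> z0) ((map (L z0) us)[j := B v (us ! j)]))"
    if "length us = k" for us v
  proof -
    have *: "map (\<lambda>j. L z (us ! j)) [0..<k] = map (L z) us" for z
      using that by (auto intro: nth_equalityI)
    have "((\<lambda>z. \<omega> c' (\<tau> z) (map (\<lambda>j. L z (us ! j)) [0..<k] @ [])) has_derivative
     (\<lambda>v. frechet_derivative (\<lambda>y. \<omega> c' y (map (\<lambda>j. L z0 (us ! j)) [0..<k] @ [])) (at (\<tau> z0)) (L z0 v) +
          (\<Sum>j<k. \<omega> c' (\<tau> z0) ((map (\<lambda>j. L z0 (us ! j)) [0..<k] @ [])[j := B v (us ! j)])))) (at z0)"
    proof (rule multilinear_chain_rule[OF cimg_open[OF manifold assms(3)]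
          forms_multilinear[OF assms(1,3)] _ U \<tau>U])
      show "(\<lambda>y. \<omega> c' y us) differentiable (at (\<tau> z0))" for us
        using forms_has_derivative[OF assms(1,3) \<tau>U[OF U(2)]] differentiableI by blast
      show "(\<tau> has_derivative L z0) (at z0)"
        unfolding L_def by (rule smooth_on_has_derivative[OF \<tau> U(2)])
    qed (use L' in auto)
    then have "((\<lambda>z. \<omega> c' (\<tau> z) (map (L z) us)) has_derivative
       (\<lambda>v. frechet_derivative (\<lambda>y. \<omega> c' y (map (L z0) us)) (at (\<tau> z0)) (L z0 v) +
          (\<Sum>j<k. \<omega> c' (\<tau> z0) ((map (L z0) us)[j := B v (us ! j)])))) (at z0)"
      by (simp add: *)
    then have "((\<lambda>z. \<omega> c z us) has_derivative
       (\<lambda>v. frechet_derivative (\<lambda>y. \<omega> c' y (map (L z0) us)) (at (\<tau> z0)) (L z0 v) +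
          (\<Sum>j<k. \<omega> c' (\<tau> z0) ((map (L z0) us)[j := B v (us ! j)])))) (at z0)"
    proof (rule has_derivative_transform_within_open[OF _ U])
      fix z assume "z \<in> U"
      then obtain x' where x': "x' \<in> cdom c \<inter> cdom c'" "z = cmap c x'" by (auto simp: U_def)
      then have "\<omega> c z us = \<omega> c' (cmap c' x') (map (transition_deriv c c' x') us)"
        using forms_transform[OF assms(1-3) x'(1) that] by simp
      then show "\<omega> c' (\<tau> z) (map (L z) us) = \<omega> c z us"
        using x' \<tau>_cmap by (simp add: L_def \<tau>_def transition_deriv_def)
    qed
    from fun_cong[OF frechet_derivative_at[OF this], of v] show ?thesis by simp
  qed
  have z0: "z0 \<in> cimg c" and \<tau>z0: "\<tau> z0 = cmap c' x" "cmap c' x \<in> cimg c'"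
    using assms(4) \<tau>_cmap cmap_in_cimg[of x c] cmap_in_cimg[of x c'] by (auto simp: z0_def)
  have "(\<Sum>j<k. \<omega> c' (\<tau> z0) ((map (L z0) (del_nth i vs))[j := B (vs ! i) (del_nth i vs ! j)])) =
     (\<Sum>j<k. \<omega> c' (\<tau> z0) ((del_nth i (map (L z0) vs))
        [j := B (vs ! i) (vs ! (if j < i then j else Suc j))]))"
    if "i < Suc k" for i
    using that assms(5) by (intro sum.cong refl) (simp add: map_del_nth nth_del_nth)
  then have "(\<Sum>i<Suc k. (-1) ^ i * (\<Sum>j<k. \<omega> c' (\<tau> z0)
      ((map (L z0) (del_nth i vs))[j := B (vs ! i) (del_nth i vs ! j)]))) =
     (\<Sum>i<Suc k. (-1) ^ i * (\<Sum>j<k. \<omega> c' (\<tau> z0) ((del_nth i (map (L z0) vs))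
        [j := B (vs ! i) (vs ! (if j < i then j else Suc j))])))"
    by simp
  also have "\<dots> = 0"
    using assms(5) alternating_sum_symmetric_insertion[OF forms_alternating[OF assms(1,3) \<tau>U[OF U(2)]],
      of "map (L z0) vs" "\<lambda>i j. B (vs ! i) (vs ! j)"] B_sym by simp
  finally have cancel: "(\<Sum>i<Suc k. (-1) ^ i * (\<Sum>j<k. \<omega> c' (\<tau> z0)
      ((map (L z0) (del_nth i vs))[j := B (vs ! i) (del_nth i vs ! j)]))) = 0" .
  have "ext_deriv A \<omega> c z0 vs =
      (\<Sum>i<Suc k. (-1) ^ i * frechet_derivative (\<lambda>z. \<omega> c z (del_nth i vs)) (at z0) (vs ! i))"
    using assms(2,5) z0 by (simp add: ext_deriv_eq)
  also have "\<dots> = (\<Sum>i<Suc k. (-1) ^ i *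
        frechet_derivative (\<lambda>y. \<omega> c' y (map (L z0) (del_nth i vs))) (at (\<tau> z0)) (L z0 (vs ! i)) +
      (-1) ^ i * (\<Sum>j<k. \<omega> c' (\<tau> z0)
        ((map (L z0) (del_nth i vs))[j := B (vs ! i) (del_nth i vs ! j)])))"
    using assms(5) by (intro sum.cong refl) (simp add: deriv distrib_left)
  also have "\<dots> = (\<Sum>i<Suc k. (-1) ^ i *
        frechet_derivative (\<lambda>y. \<omega> c' y (map (L z0) (del_nth i vs))) (at (\<tau> z0)) (L z0 (vs ! i)))"
    unfolding sum.distrib cancel by simp
  also have "\<dots> = ext_deriv A \<omega> c' (cmap c' x) (map (L z0) vs)"
    using assms(3,5) \<tau>z0 by (simp add: ext_deriv_eq map_del_nth del: sum.lessThan_Suc)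
  finally show ?thesis by (simp add: z0_def L_def \<tau>_def transition_deriv_def)
qed

lemma ext_deriv_forms: "\<omega> \<in> forms A k \<Longrightarrow> ext_deriv A \<omega> \<in> forms A (Suc k)"
  unfolding mem_forms_iff[OF manifold, of "ext_deriv A \<omega>"]
  by (intro conjI allI ballI impI)
    (blast intro: ext_deriv_vanish ext_deriv_alternating ext_deriv_smooth ext_deriv_transform)+

lemma forms_zero: "0 \<in> forms A k"
  unfolding mem_forms_iff[OF manifold] alternating_def multilinear_def
  by (simp add: smooth_on_const linear_zero)

lemma forms_add:
  assumes "\<omega> \<in> forms A k" "\<eta> \<in> forms A k"
  shows "\<omega> + \<eta> \<in> forms A k"
  unfolding mem_forms_iff[OF manifold, of "\<omega> + \<eta>"]
proof (intro conjI allI ballI impI)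
  show "(\<omega> + \<eta>) c y vs = 0" if "\<not> (c \<in> A \<and> y \<in> cimg c \<and> length vs = k)" for c y vs
    using forms_vanish[OF assms(1) that] forms_vanish[OF assms(2) that] by simp
  show "alternating k ((\<omega> + \<eta>) c y)" if "c \<in> A" "y \<in> cimg c" for c y
    using forms_alternating[OF assms(1) that] forms_alternating[OF assms(2) that]
    by (simp add: alternating_def multilinear_def linear_compose_add)
  show "smooth_on (cimg c) (\<lambda>y. (\<omega> + \<eta>) c y vs)" if "c \<in> A" for c vs
    using smooth_on_add[OF cimg_open[OF manifold that] forms_smooth[OF assms(1) that]
        forms_smooth[OF assms(2) that]] by simp
  show "(\<omega> + \<eta>) c (cmap c x) vs = (\<omega> + \<eta>) c' (cmap c' x) (map (transition_deriv c c' x) vs)"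
    if "c \<in> A" "c' \<in> A" "x \<in> cdom c \<inter> cdom c'" "length vs = k" for c c' x vs
    using forms_transform[OF assms(1) that] forms_transform[OF assms(2) that] by simp
qed

lemma forms_scale:
  assumes "\<omega> \<in> forms A k"
  shows "form_scale r \<omega> \<in> forms A k"
  unfolding mem_forms_iff[OF manifold, of "form_scale r \<omega>"]
proof (intro conjI allI ballI impI)
  show "form_scale r \<omega> c y vs = 0" if "\<not> (c \<in> A \<and> y \<in> cimg c \<and> length vs = k)" for c y vs
    using forms_vanish[OF assms that] by (simp add: form_scale_def)
  show "alternating k (form_scale r \<omega> c y)" if "c \<in> A" "y \<in> cimg c" for c y
  proof -
    have "linear (\<lambda>v. r *\<^sub>R \<omega> c y (vs[i := v]))" if "length vs = k" "i < k" for vs i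
      using forms_multilinear[OF assms \<open>c \<in> A\<close> \<open>y \<in> cimg c\<close>] that
      by (intro linear_compose_scale_right) (simp add: multilinear_def)
    then show ?thesis
      using forms_alternating[OF assms that]
      by (simp add: alternating_def multilinear_def form_scale_def)
  qed
  show "smooth_on (cimg c) (\<lambda>y. form_scale r \<omega> c y vs)" if "c \<in> A" for c vs
    using smooth_on_cmult[OF cimg_open[OF manifold that] forms_smooth[OF assms that]]
    by (simp add: form_scale_def)
  show "form_scale r \<omega> c (cmap c x) vs =
      form_scale r \<omega> c' (cmap c' x) (map (transition_deriv c c' x) vs)"
    if "c \<in> A" "c' \<in> A" "x \<in> cdom c \<inter> cdom c'" "length vs = k" for c c' x vs
    using forms_transform[OF assms that] by (simp add: form_scale_def)
qed

lemma ext_deriv_add: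
  assumes "\<omega> \<in> forms A k" "\<eta> \<in> forms A k"
  shows "ext_deriv A (\<omega> + \<eta>) = ext_deriv A \<omega> + ext_deriv A \<eta>"
proof (intro ext)
  fix c y vs
  show "ext_deriv A (\<omega> + \<eta>) c y vs = (ext_deriv A \<omega> + ext_deriv A \<eta>) c y vs"
  proof (cases "c \<in> A \<and> y \<in> cimg c")
    case True
    have "frechet_derivative (\<lambda>z. (\<omega> + \<eta>) c z us) (at y) v =
        frechet_derivative (\<lambda>z. \<omega> c z us) (at y) v + frechet_derivative (\<lambda>z. \<eta> c z us) (at y) v"
      for us v
      using frechet_derivative_at[OF has_derivative_add[OF forms_has_derivative[OF assms(1)]
            forms_has_derivative[OF assms(2)]], of c y c us us] True
      by (simp add: fun_eq_iff)
    then show ?thesis using True by (simp add: ext_deriv_eq sum.distrib distrib_left)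
  qed (auto simp: ext_deriv_def)
qed

lemma ext_deriv_scale:
  assumes "\<omega> \<in> forms A k"
  shows "ext_deriv A (form_scale r \<omega>) = form_scale r (ext_deriv A \<omega>)"
proof (intro ext)
  fix c y vs
  show "ext_deriv A (form_scale r \<omega>) c y vs = form_scale r (ext_deriv A \<omega>) c y vs"
  proof (cases "c \<in> A \<and> y \<in> cimg c")
    case True
    have "frechet_derivative (\<lambda>z. form_scale r \<omega> c z us) (at y) v =
        r * frechet_derivative (\<lambda>z. \<omega> c z us) (at y) v" for us v
      using frechet_derivative_at[OF has_derivative_scaleR_right[OF forms_has_derivative[OF assms]],
          of c y r us] True
      by (simp add: fun_eq_iff form_scale_def)
    then show ?thesis
      using True by (simp add: ext_deriv_eq form_scale_def sum_distrib_left mult.left_commute)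
  qed (auto simp: ext_deriv_def form_scale_def)
qed

end

section \<open>The Schouten trace of an Einstein metric\<close>

text \<open>Contracting \<open>\<kappa> g\<close> with the inverse metric gives \<open>\<kappa>\<close> times the trace of the identity.\<close>

lemma scal_einstein:
  fixes g :: "('a, 'n::finite) metric"
  assumes "pseudo_riemannian_metric A g" "c \<in> A" "y \<in> cimg c"
    and \<kappa>: "\<And>i j. ricci g c i j y = \<kappa> * g c y $ i $ j"
  shows "scal g c y = \<kappa> * real CARD('n)"
proof -
  have sym: "transpose (g c y) = g c y" and inv: "invertible (g c y)"
    using assms(1-3) by (auto simp: pseudo_riemannian_metric_def)
  have g_sym: "g c y $ i $ j = g c y $ j $ i" for i j
    by (subst sym[symmetric]) (simp add: transpose_def)
  have "ginv g c y ** g c y = mat 1"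
    using inv someI_ex[of "\<lambda>B. g c y ** B = mat 1 \<and> B ** g c y = mat 1"]
    by (simp add: ginv_def matrix_inv_def invertible_def)
  then have "(ginv g c y ** g c y) $ i $ i = 1" for i
    by (simp add: mat_def)
  then have one: "(\<Sum>j\<in>UNIV. ginv g c y $ i $ j * g c y $ j $ i) = 1" for i
    by (simp add: matrix_matrix_mult_def)
  have "scal g c y = (\<Sum>i\<in>UNIV. \<kappa> * (\<Sum>j\<in>UNIV. ginv g c y $ i $ j * g c y $ j $ i))"
    unfolding scal_def \<kappa> sum_distrib_left
    by (intro sum.cong refl) (simp add: g_sym mult.left_commute)
  then show ?thesis by (simp add: one)
qed

lemma schouten_trace_nonzero:
  fixes g :: "('a, 'n::finite) metric"
  assumes "pseudo_riemannian_metric A g" "einstein A g" "\<not> ricci_flat A g" "CARD('n) > 1"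
  shows "schouten_trace A g \<noteq> 0"
proof -
  obtain \<kappa> where \<kappa>: "\<And>c y i j. c \<in> A \<Longrightarrow> y \<in> cimg c \<Longrightarrow> ricci g c i j y = \<kappa> * g c y $ i $ j"
    using assms(2) unfolding einstein_def by blast
  obtain c y i j where cy: "c \<in> A" "y \<in> cimg c" "ricci g c i j y \<noteq> 0"
    using assms(3) by (auto simp: ricci_flat_def)
  then have "\<kappa> \<noteq> 0" using \<kappa> by auto
  have scal: "scal g c y = \<kappa> * real CARD('n)" if "c \<in> A" "y \<in> cimg c" for c y
    using scal_einstein[OF assms(1) that \<kappa>[OF that]] .
  have "schouten_trace A g = \<kappa> * real CARD('n) / (2 * (real CARD('n) - 1))"
    unfolding schouten_trace_def
    by (rule the_equality) (use scal cy(1,2) in auto)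
  then show ?thesis using \<open>\<kappa> \<noteq> 0\<close> assms(4) by simp
qed

lemma scale_density_nonzero:
  assumes "pseudo_riemannian_metric A g" "c \<in> A" "y \<in> cimg c"
  shows "scale_density g c y \<noteq> 0"
proof -
  have "det (g c y) \<noteq> 0"
    using assms invertible_det_nz by (auto simp: pseudo_riemannian_metric_def)
  then show ?thesis by (simp add: scale_density_def)
qed

text \<open>
  With \<open>n = 2 k + 2 p\<close> the eigenvalue \<open>\<lambda>\<^sub>i\<close> is a nonzero multiple of \<open>i (2 p - 1 - i)\<close>, which is
  strictly increasing for \<open>0 \<le> i \<le> p - 1\<close>.
\<close>

lemma eigenval_inj:
  fixes A :: "('a, 'n::finite) chart set"
  assumes "schouten_trace A g \<noteq> 0" "CARD('n) = 2 * k + 2 * p"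
  shows "inj_on (eigenval A g (k + 1)) {..<p}"
proof (rule inj_onI)
  fix i j assume ij: "i \<in> {..<p}" "j \<in> {..<p}" "eigenval A g (k + 1) i = eigenval A g (k + 1) j"
  define q where "q = 2 * real p - 1"
  have ev: "eigenval A g (k + 1) i = - (2 * (real i * (q - real i)) / real CARD('n)) * schouten_trace A g"
    for i
    unfolding eigenval_def q_def using assms(2) by (simp add: algebra_simps)
  have "real CARD('n) \<noteq> 0" by simp
  then have "real i * (q - real i) = real j * (q - real j)"
    using ij(3) assms(1) unfolding ev by simp
  then have "(real i - real j) * (q - real i - real j) = 0" by (simp add: algebra_simps)
  moreover have "real i + 1 \<le> real p" "real j + 1 \<le> real p" using ij(1,2) by auto
  then have "q - real i - real j \<noteq> 0" by (simp add: q_def)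
  ultimately show "i = j" by simp
qed

lemma eigenval_zero: "eigenval A g k 0 = 0"
  by (simp add: eigenval_def)

section \<open>The null space of \<open>L\<^sub>k\<close>\<close>

lemma vector_space_form_scale: "vector_space (form_scale :: real \<Rightarrow> ('a, 'n::finite) form \<Rightarrow> _)"
  by unfold_locales (auto simp: form_scale_def fun_eq_iff algebra_simps)

locale adjoint_on_atlas = atlas M A for M :: "'a topology" and A :: "('a, 'n::finite) chart set" +
  fixes g :: "('a, 'n) metric" and \<mu> :: "'a measure"
    and \<delta> :: "('a, 'n) form \<Rightarrow> ('a, 'n) form"
  assumes adjoint: "formal_adjoint_d M A g \<mu> \<delta>"
begin

lemma \<delta>_forms: "\<beta> \<in> forms A (Suc k) \<Longrightarrow> \<delta> \<beta> \<in> forms A k"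
  using adjoint unfolding formal_adjoint_d_def by blast

lemma \<delta>_add:
  "\<beta> \<in> forms A (Suc k) \<Longrightarrow> \<beta>' \<in> forms A (Suc k) \<Longrightarrow> \<delta> (\<beta> + \<beta>') = \<delta> \<beta> + \<delta> \<beta>'"
  using adjoint unfolding formal_adjoint_d_def by blast

lemma \<delta>_scale: "\<beta> \<in> forms A (Suc k) \<Longrightarrow> \<delta> (form_scale r \<beta>) = form_scale r (\<delta> \<beta>)"
  using adjoint unfolding formal_adjoint_d_def by blast

sublocale \<delta>d: operator_on_subspace form_scale "forms A k" "\<lambda>f. \<delta> (ext_deriv A f)" for k
proof -
  interpret vector_space "form_scale :: real \<Rightarrow> ('a, 'n) form \<Rightarrow> _"
    by (rule vector_space_form_scale)
  show "operator_on_subspace form_scale (forms A k) (\<lambda>f. \<delta> (ext_deriv A f))"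
    by unfold_locales
      (auto simp: subspace_def forms_zero forms_add forms_scale ext_deriv_add ext_deriv_scale
        intro: \<delta>_forms ext_deriv_forms \<delta>_add \<delta>_scale)
qed

lemma eigenspace_eq: "\<delta>d.eigenspace k c = H_tilde A \<delta> k c"
  by (simp add: \<delta>d.eigenspace_def H_tilde_def)

text \<open>The identity \<open>(d\<delta> + a) d = d (\<delta>d + a)\<close> moves \<open>d\<close> to the left through the product.\<close>

lemma L_product_ext_deriv:
  assumes "f \<in> forms A k"
  shows "L_product A g \<delta> k m (ext_deriv A f) =
         ext_deriv A (\<delta>d.shift_product (\<lambda>i. eigenval A g (k + 1) (Suc i)) m f)"
proof (induction m)
  case (Suc m)
  define h where "h = \<delta>d.shift_product (\<lambda>i. eigenval A g (k + 1) (Suc i)) m f"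
  define a where "a = eigenval A g (k + 1) (Suc m)"
  have h: "h \<in> forms A k" "\<delta> (ext_deriv A h) \<in> forms A k"
    using \<delta>d.shift_product_closed[OF assms] \<delta>d.T_closed by (simp_all add: h_def)
  have a: "2 * real (Suc m) * (real CARD('n) - 2 * real k - real (Suc m) - 1) / real CARD('n) *
      schouten_trace A g = - a"
    by (simp add: a_def eigenval_def algebra_simps)
  have "L_product A g \<delta> k (Suc m) (ext_deriv A f) =
      ext_deriv A (\<delta> (ext_deriv A h)) + form_scale (- a) (ext_deriv A h)"
    using Suc by (simp only: L_product.simps Let_def a h_def)
  also have "\<dots> = ext_deriv A (\<delta> (ext_deriv A h) + form_scale (- a) h)"
    by (simp only: ext_deriv_add[OF h(2) forms_scale[OF h(1)]] ext_deriv_scale[OF h(1)])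
  also have "\<delta> (ext_deriv A h) + form_scale (- a) h = \<delta> (ext_deriv A h) - form_scale a h"
    by (simp add: form_scale_def fun_eq_iff)
  finally show ?case by (simp add: h_def a_def)
qed simp

text \<open>
  The outer factor \<open>\<delta>d\<close> of \<open>L\<^sub>k\<close> is \<open>\<delta>d - \<lambda>\<^sub>0\<close>, since \<open>\<lambda>\<^sub>0 = 0\<close>; and multiplication by a power of the
  scale is injective.
\<close>

lemma null_L_eq_kernel:
  assumes "pseudo_riemannian_metric A g" "CARD('n) = 2 * k + 2 * Suc m"
  shows "null_L A g \<delta> k =
    {f \<in> forms A k. \<delta>d.shift_product (eigenval A g (k + 1)) (Suc m) f = 0}"
proof -
  have "L_op A g \<delta> k f = 0 \<longleftrightarrow> \<delta>d.shift_product (eigenval A g (k + 1)) (Suc m) f = 0"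
    if f: "f \<in> forms A k" for f
  proof -
    define h where "h = \<delta> (L_product A g \<delta> k m (ext_deriv A f))"
    define l where "l = (\<lambda>i. eigenval A g (k + 1) (Suc i))"
    have h_eq: "h = \<delta> (ext_deriv A (\<delta>d.shift_product l m f))"
      by (simp only: h_def L_product_ext_deriv[OF f] l_def)
    also have "\<dots> = \<delta>d.shift_product l m (\<delta> (ext_deriv A f))"
      using \<delta>d.shift_product_commute[OF f, of l m 0] by simp
    also have "\<dots> = \<delta>d.shift_product (eigenval A g (k + 1)) (Suc m) f"
      unfolding \<delta>d.shift_product_Suc_left by (simp add: l_def eigenval_zero del: One_nat_def)
    finally have h: "h = \<delta>d.shift_product (eigenval A g (k + 1)) (Suc m) f" .
    have "h \<in> forms A k"
      unfolding h_eq by (intro \<delta>d.T_closed \<delta>d.shift_product_closed f)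
    then have off: "h c y vs = 0" if "\<not> (c \<in> A \<and> y \<in> cimg c)" for c y vs
      using forms_vanish that by blast
    have "(CARD('n) - 2 * k - 2) div 2 = m" "2 * k < CARD('n)" using assms(2) by auto
    then have "L_op A g \<delta> k f =
        (\<lambda>c y vs. scale_density g c y powr (2 * real k - real CARD('n)) * h c y vs)"
      by (simp add: L_op_def h_def)
    then have "L_op A g \<delta> k f = 0 \<longleftrightarrow>
        (\<forall>c y vs. scale_density g c y powr (2 * real k - real CARD('n)) * h c y vs = 0)"
      by (simp add: fun_eq_iff)
    also have "\<dots> \<longleftrightarrow> (\<forall>c y vs. h c y vs = 0)"
      using scale_density_nonzero[OF assms(1)] off by (metis mult_eq_0_iff powr_eq_0_iff)
    also have "\<dots> \<longleftrightarrow> h = 0" by (simp add: fun_eq_iff)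
    finally show ?thesis by (simp only: h)
  qed
  then show ?thesis unfolding null_L_def by blast
qed

end

theorem proposition5p3:
  fixes M :: "'a topology"
    and A :: "('a, 'n::finite) chart set"
    and g :: "('a, 'n) metric"
    and \<mu> :: "'a measure"
    and \<delta> :: "('a, 'n) form \<Rightarrow> ('a, 'n) form"
    and n :: nat
  assumes "n = CARD('n)" and "n \<ge> 4" and "even n"
    and "smooth_manifold M A"
    and "pseudo_riemannian_metric A g"
    and "einstein A g"
    and "\<not> ricci_flat A g"
    and "volume_measure M A g \<mu>"
    and "formal_adjoint_d M A g \<mu> \<delta>"
  shows "(\<forall>k p. k \<le> n div 2 - 1 \<longrightarrow> p = (n - 2 * k) div 2 \<longrightarrow>
            is_direct_sum (null_L A g \<delta> k) {0..p - 1}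
              (\<lambda>i. if i = 0 then H_tilde A \<delta> k 0
                   else H_tilde A \<delta> k (eigenval A g (k + 1) i)))
       \<and> null_L A g \<delta> (n div 2) = forms A (n div 2)
       \<and> forms A (n div 2) = dual_forms A (n div 2)"
proof (intro conjI allI impI)
  interpret adjoint_on_atlas M A g \<mu> \<delta>
    using assms by unfold_locales auto
  have J: "schouten_trace A g \<noteq> 0"
    using assms(1,2,5-7) by (intro schouten_trace_nonzero) auto
  fix k p assume k: "k \<le> n div 2 - 1" and p: "p = (n - 2 * k) div 2"
  obtain m where m: "p = Suc m" "CARD('n) = 2 * k + 2 * Suc m"
  proof
    show "p = Suc (p - 1)" "CARD('n) = 2 * k + 2 * Suc (p - 1)"
      using k p assms(1-3) by auto
  qed
  have eigen: "(if i = 0 then H_tilde A \<delta> k 0 else H_tilde A \<delta> k (eigenval A g (k + 1) i)) =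
      \<delta>d.eigenspace k (eigenval A g (k + 1) i)" for i
    by (simp add: eigenspace_eq eigenval_zero)
  have "{0..p - 1} = {..<p}" using m by auto
  moreover have "inj_on (eigenval A g (k + 1)) {..<p}"
    using eigenval_inj[OF J] m by blast
  ultimately show "is_direct_sum (null_L A g \<delta> k) {0..p - 1}
      (\<lambda>i. if i = 0 then H_tilde A \<delta> k 0 else H_tilde A \<delta> k (eigenval A g (k + 1) i))"
    using \<delta>d.kernel_shift_product[of "eigenval A g (k + 1)" p k]
    unfolding eigen null_L_eq_kernel[OF assms(5) m(2)] m(1) by simp
next
  show "null_L A g \<delta> (n div 2) = forms A (n div 2)"
    using assms(1,3) by (auto simp: null_L_def L_op_def)
  have "2 * real (n div 2) - real CARD('n) = 0"
    using assms(1,3) by (auto elim: evenE)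
  then show "forms A (n div 2) = dual_forms A (n div 2)"
    by (simp add: forms_def dual_forms_def)
qed

end
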